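(* Let $X$ be a smooth manifold, possibly with boundary, with interior $X^\circ$, endowed with a fixed positive smooth density $d\mu$. Let $L:\operatorname{Dom}(L)\subset L^2(X)\to L^2(X)$ be self-adjoint and let $\mathcal Q$ be an admissible perturbation space on $X$. If $C_c^\infty(X^\circ,\mathbb R)\subset\mathcal Q$, then the pair $(L,\mathcal Q)$ satisfies Hypothesis (H).
   Context: $L^2(X):=L^2(X,\mathbb C;d\mu)$. An admissible perturbation space on $X$ is a real Fréchet space $\mathcal Q$ together with a continuous injective linear map $\iota:\mathcal Q\to L^\infty(X,\mathbb R)$; $q\in\mathcal Q$ is identified with $\iota(q)$, so the inclusion $C_c^\infty(X^\circ,\mathbb R)\subset\mathcal Q$ means inclusion in $\iota(\mathcal Q)$. For $q\in\mathcal Q$, $M_q$ is multiplication by $q$ and $L_q:=L+M_q$. Hypothesis (H) for the pair $(L,\mathcal Q)$: for every $q\in\mathcal Q$ and every eigenvalue $\lambda$ of $L_q$ with $\dim E_{q,\lambda}\ge 2$, where $E_{q,\lambda}:=\ker(L_q-\lambda I)$, there exists $\sigma\in\mathcal Q$ such that $G_\sigma:=(P_{E_{q,\lambda}}M_\sigma)|_{E_{q,\lambda}}:E_{q,\lambda}\to E_{q,\lambda}$ is not of the form $cI_{E_{q,\lambda}}$ with $c\in\mathbb R$; here $P_{E_{q,\lambda}}$ is the orthogonal projection of $L^2(X)$ onto $E_{q,\lambda}$. *)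

theory Defs
  imports "HOL-Probability.Probability"
begin

section \<open>Smooth manifolds with boundary and smooth densities\<close>

primrec Ck_on :: "nat \<Rightarrow> 'e::real_normed_vector set \<Rightarrow> ('e \<Rightarrow> 'f::real_normed_vector) \<Rightarrow> bool" where
  "Ck_on 0 W f \<longleftrightarrow> continuous_on W f"
| "Ck_on (Suc k) W f \<longleftrightarrow>
     (\<forall>x\<in>W. f differentiable (at x)) \<and> (\<forall>v. Ck_on k W (\<lambda>x. frechet_derivative f (at x) v))"

text \<open>Smoothness on a set that need not be open (a relatively open part of a half-space, say)
  means local extendability to a smooth function on an open set.\<close>

definition smooth_on :: "'e::real_normed_vector set \<Rightarrow> ('e \<Rightarrow> 'f::real_normed_vector) \<Rightarrow> bool" where
  "smooth_on S f \<longleftrightarrow>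
     (\<forall>x\<in>S. \<exists>W F. open W \<and> x \<in> W \<and> (\<forall>k. Ck_on k W F) \<and> (\<forall>y\<in>S \<inter> W. F y = f y))"

text \<open>The types of class \<^class>\<open>euclidean_space\<close> have positive dimension. So that 0-dimensional
  manifolds are covered, the dimension \<open>n\<close> is either the dimension of the type \<open>'e\<close> of
  coordinates or 0; in the second case the origin of \<open>'e\<close> plays the role of the one-point
  coordinate space, with the unit point mass in place of Lebesgue measure.\<close>

definition coord_space :: "nat \<Rightarrow> 'e::euclidean_space set" where
  "coord_space n = (if n = 0 then {0} else UNIV)"

definition coord_halfspace :: "nat \<Rightarrow> 'e::euclidean_space set" where
  "coord_halfspace n = {x \<in> coord_space n. 0 \<le> x \<bullet> (SOME b. b \<in> Basis)}"

definition coord_measure :: "nat \<Rightarrow> 'e::euclidean_space measure" where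
  "coord_measure n = (if n = 0 then return borel 0 else lborel)"

type_synonym ('a, 'e) chart = "'a set \<times> ('a \<Rightarrow> 'e)"

definition is_chart ::
  "nat \<Rightarrow> ('a::topological_space, 'e::euclidean_space) chart \<Rightarrow> bool" where
  "is_chart n = (\<lambda>(U, \<phi>). open U \<and> homeomorphism U (\<phi> ` U) \<phi> (inv_into U \<phi>) \<and>
     (openin (top_of_set (coord_space n)) (\<phi> ` U) \<or>
      openin (top_of_set (coord_halfspace n)) (\<phi> ` U)))"

text \<open>The manifold is the whole type \<open>'a\<close>; its smooth structure is the one given by the atlas
  (which need not be maximal).\<close>

definition smooth_manifold_with_boundary ::
  "nat \<Rightarrow> ('a::{t2_space, second_countable_topology}, 'e::euclidean_space) chart set \<Rightarrow> bool" where
  "smooth_manifold_with_boundary n \<A> \<longleftrightarrow>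
     (n = DIM('e) \<or> n = 0) \<and>
     (\<forall>c\<in>\<A>. is_chart n c) \<and>
     (\<Union>(U, \<phi>)\<in>\<A>. U) = UNIV \<and>
     (\<forall>(U, \<phi>)\<in>\<A>. \<forall>(V, \<psi>)\<in>\<A>. smooth_on (\<phi> ` (U \<inter> V)) (\<psi> \<circ> inv_into U \<phi>))"

definition manifold_interior ::
  "nat \<Rightarrow> ('a::topological_space, 'e::euclidean_space) chart set \<Rightarrow> 'a set" where
  "manifold_interior n \<A> =
     {p. \<exists>(U, \<phi>)\<in>\<A>. p \<in> U \<and>
           (\<exists>W. openin (top_of_set (coord_space n)) W \<and> \<phi> p \<in> W \<and> W \<subseteq> \<phi> ` U)}"

definition smooth_fun ::
  "('a::topological_space, 'e::euclidean_space) chart set \<Rightarrow> ('a \<Rightarrow> real) \<Rightarrow> bool" where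
  "smooth_fun \<A> f \<longleftrightarrow> (\<forall>(U, \<phi>)\<in>\<A>. smooth_on (\<phi> ` U) (f \<circ> inv_into U \<phi>))"

text \<open>\<open>C\<^sub>c\<^sup>\<infinity>\<close> of the interior, each function being extended by zero to the whole manifold.\<close>

definition Cc_infty_interior ::
  "nat \<Rightarrow> ('a::topological_space, 'e::euclidean_space) chart set \<Rightarrow> ('a \<Rightarrow> real) set" where
  "Cc_infty_interior n \<A> =
     {f. smooth_fun \<A> f \<and> compact (closure {x. f x \<noteq> 0}) \<and>
         closure {x. f x \<noteq> 0} \<subseteq> manifold_interior n \<A>}"

text \<open>A positive smooth density, as a measure: in every chart it is \<open>\<rho> dx\<close> with \<open>\<rho>\<close> smooth
  and positive.\<close>

definition positive_smooth_density ::
  "nat \<Rightarrow> ('a::topological_space, 'e::euclidean_space) chart set \<Rightarrow> 'a measure \<Rightarrow> bool" where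
  "positive_smooth_density n \<A> \<mu> \<longleftrightarrow>
     sets \<mu> = sets borel \<and>
     (\<forall>(U, \<phi>)\<in>\<A>. \<exists>\<rho>::'e \<Rightarrow> real.
        smooth_on (\<phi> ` U) \<rho> \<and> (\<forall>x\<in>\<phi> ` U. 0 < \<rho> x) \<and>
        distr (restrict_space \<mu> U) borel \<phi> =
          density (coord_measure n) (\<lambda>x. ennreal (\<rho> x) * indicator (\<phi> ` U) x))"

section \<open>Spaces of classes of measurable functions\<close>

text \<open>Elements of \<open>L\<^sup>2\<close> and \<open>L\<^sup>\<infinity>\<close> are classes of almost everywhere equal measurable functions;
  the operations are computed on representatives.\<close>

type_synonym ('a, 'b) fclass = "('a \<Rightarrow> 'b) set"

definition ae_class :: "'a measure \<Rightarrow> ('a \<Rightarrow> 'b::topological_space) \<Rightarrow> ('a, 'b) fclass" where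
  "ae_class M f = {g \<in> borel_measurable M. AE x in M. g x = f x}"

definition rep :: "('a, 'b) fclass \<Rightarrow> 'a \<Rightarrow> 'b" where
  "rep u = (SOME f. f \<in> u)"

definition ae_zero :: "'a measure \<Rightarrow> ('a, 'b::real_normed_field) fclass" where
  "ae_zero M = ae_class M (\<lambda>x. 0)"

definition ae_add ::
  "'a measure \<Rightarrow> ('a, 'b::real_normed_field) fclass \<Rightarrow> ('a, 'b) fclass \<Rightarrow> ('a, 'b) fclass" where
  "ae_add M u v = ae_class M (\<lambda>x. rep u x + rep v x)"

definition ae_diff ::
  "'a measure \<Rightarrow> ('a, 'b::real_normed_field) fclass \<Rightarrow> ('a, 'b) fclass \<Rightarrow> ('a, 'b) fclass" where
  "ae_diff M u v = ae_class M (\<lambda>x. rep u x - rep v x)"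

definition ae_scale ::
  "'a measure \<Rightarrow> 'b \<Rightarrow> ('a, 'b::real_normed_field) fclass \<Rightarrow> ('a, 'b) fclass" where
  "ae_scale M c u = ae_class M (\<lambda>x. c * rep u x)"

definition Linf :: "'a measure \<Rightarrow> ('a, real) fclass set" where
  "Linf M = ae_class M ` {f \<in> borel_measurable M. \<exists>C. AE x in M. \<bar>f x\<bar> \<le> C}"

definition Linf_norm :: "'a measure \<Rightarrow> ('a, real) fclass \<Rightarrow> real" where
  "Linf_norm M u = real_of_ereal (esssup M (\<lambda>x. ereal \<bar>rep u x\<bar>))"

definition Linf_topology :: "'a measure \<Rightarrow> ('a, real) fclass topology" where
  "Linf_topology M = Metric_space.mtopology (Linf M) (\<lambda>u v. Linf_norm M (ae_diff M u v))"

definition L2 :: "'a measure \<Rightarrow> ('a, complex) fclass set" where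
  "L2 M = ae_class M ` {f \<in> borel_measurable M. integrable M (\<lambda>x. (cmod (f x))\<^sup>2)}"

definition L2_inner :: "'a measure \<Rightarrow> ('a, complex) fclass \<Rightarrow> ('a, complex) fclass \<Rightarrow> complex" where
  "L2_inner M u v = (LINT x|M. rep u x * cnj (rep v x))"

definition L2_norm :: "'a measure \<Rightarrow> ('a, complex) fclass \<Rightarrow> real" where
  "L2_norm M u = sqrt (LINT x|M. (cmod (rep u x))\<^sup>2)"

definition L2_subspace :: "'a measure \<Rightarrow> ('a, complex) fclass set \<Rightarrow> bool" where
  "L2_subspace M E \<longleftrightarrow> E \<subseteq> L2 M \<and> ae_zero M \<in> E \<and>
     (\<forall>u\<in>E. \<forall>v\<in>E. ae_add M u v \<in> E) \<and> (\<forall>c. \<forall>u\<in>E. ae_scale M c u \<in> E)"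

definition L2_independent :: "'a measure \<Rightarrow> ('a, complex) fclass set \<Rightarrow> bool" where
  "L2_independent M B \<longleftrightarrow>
     (\<forall>c. ae_class M (\<lambda>x. \<Sum>u\<in>B. c u * rep u x) = ae_zero M \<longrightarrow> (\<forall>u\<in>B. c u = 0))"

text \<open>Complex dimension; the value is \<open>\<infinity>\<close> for every infinite-dimensional subspace.\<close>

definition L2_dim :: "'a measure \<Rightarrow> ('a, complex) fclass set \<Rightarrow> enat" where
  "L2_dim M E = (SUP B\<in>{B. finite B \<and> B \<subseteq> E \<and> L2_independent M B}. enat (card B))"

text \<open>Orthogonal projection onto a closed subspace.\<close>

definition L2_proj ::
  "'a measure \<Rightarrow> ('a, complex) fclass set \<Rightarrow> ('a, complex) fclass \<Rightarrow> ('a, complex) fclass" where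
  "L2_proj M E f = (THE g. g \<in> E \<and> (\<forall>h\<in>E. L2_inner M (ae_diff M f g) h = 0))"

section \<open>Self-adjoint operators and their perturbations\<close>

text \<open>An unbounded operator is given by its domain \<open>D\<close> and a map \<open>L\<close>, whose values outside
  \<open>D\<close> are irrelevant.\<close>

type_synonym 'a L2_map = "('a, complex) fclass \<Rightarrow> ('a, complex) fclass"

definition densely_defined_operator ::
  "'a measure \<Rightarrow> ('a, complex) fclass set \<Rightarrow> 'a L2_map \<Rightarrow> bool" where
  "densely_defined_operator M D L \<longleftrightarrow>
     L2_subspace M D \<and>
     (\<forall>f\<in>L2 M. \<forall>e>0. \<exists>u\<in>D. L2_norm M (ae_diff M f u) < e) \<and>
     (\<forall>u\<in>D. L u \<in> L2 M) \<and>
     (\<forall>u\<in>D. \<forall>v\<in>D. L (ae_add M u v) = ae_add M (L u) (L v)) \<and>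
     (\<forall>c. \<forall>u\<in>D. L (ae_scale M c u) = ae_scale M c (L u))"

definition adjoint_graph ::
  "'a measure \<Rightarrow> ('a, complex) fclass set \<Rightarrow> 'a L2_map
     \<Rightarrow> (('a, complex) fclass \<times> ('a, complex) fclass) set" where
  "adjoint_graph M D L =
     {(v, w) \<in> L2 M \<times> L2 M. \<forall>u\<in>D. L2_inner M (L u) v = L2_inner M u w}"

definition self_adjoint_operator ::
  "'a measure \<Rightarrow> ('a, complex) fclass set \<Rightarrow> 'a L2_map \<Rightarrow> bool" where
  "self_adjoint_operator M D L \<longleftrightarrow>
     densely_defined_operator M D L \<and> adjoint_graph M D L = (\<lambda>v. (v, L v)) ` D"

definition mult_op :: "'a measure \<Rightarrow> ('a, real) fclass \<Rightarrow> 'a L2_map" where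
  "mult_op M q u = ae_class M (\<lambda>x. complex_of_real (rep q x) * rep u x)"

text \<open>Multiplication by a bounded function is a bounded operator, so the perturbed operator has the
  same domain as \<open>L\<close>.\<close>

definition perturbed :: "'a measure \<Rightarrow> 'a L2_map \<Rightarrow> ('a, real) fclass \<Rightarrow> 'a L2_map" where
  "perturbed M L q u = ae_add M (L u) (mult_op M q u)"

definition eigenspace ::
  "'a measure \<Rightarrow> ('a, complex) fclass set \<Rightarrow> 'a L2_map \<Rightarrow> complex \<Rightarrow> ('a, complex) fclass set" where
  "eigenspace M D T z = {u \<in> D. ae_diff M (T u) (ae_scale M z u) = ae_zero M}"

definition eigenvalue ::
  "'a measure \<Rightarrow> ('a, complex) fclass set \<Rightarrow> 'a L2_map \<Rightarrow> complex \<Rightarrow> bool" where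
  "eigenvalue M D T z \<longleftrightarrow> (\<exists>u\<in>eigenspace M D T z. u \<noteq> ae_zero M)"

section \<open>Admissible perturbation spaces and Hypothesis (H)\<close>

definition seminorm :: "('q::real_vector \<Rightarrow> real) \<Rightarrow> bool" where
  "seminorm p \<longleftrightarrow> (\<forall>x y. p (x + y) \<le> p x + p y) \<and> (\<forall>c x. p (c *\<^sub>R x) = \<bar>c\<bar> * p x)"

definition frechet_space :: "'q::real_vector topology \<Rightarrow> bool" where
  "frechet_space T \<longleftrightarrow>
     (\<exists>p :: nat \<Rightarrow> 'q \<Rightarrow> real.
        (\<forall>k. seminorm (p k)) \<and>
        (\<forall>x. (\<forall>k. p k x = 0) \<longrightarrow> x = 0) \<and>
        (\<forall>U. openin T U \<longleftrightarrow>
           (\<forall>x\<in>U. \<exists>N. \<exists>e>0. \<forall>y. (\<forall>k\<le>N. p k (y - x) < e) \<longrightarrow> y \<in> U)) \<and>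
        (\<forall>s. (\<forall>k. \<forall>e>0. \<exists>N. \<forall>m\<ge>N. \<forall>n\<ge>N. p k (s m - s n) < e) \<longrightarrow>
             (\<exists>l. \<forall>k. (\<lambda>n. p k (s n - l)) \<longlonglongrightarrow> 0)))"

definition admissible_perturbation_space ::
  "'a measure \<Rightarrow> 'q::real_vector topology \<Rightarrow> ('q \<Rightarrow> ('a, real) fclass) \<Rightarrow> bool" where
  "admissible_perturbation_space M T \<iota> \<longleftrightarrow>
     frechet_space T \<and>
     range \<iota> \<subseteq> Linf M \<and>
     inj \<iota> \<and>
     (\<forall>q r. \<iota> (q + r) = ae_add M (\<iota> q) (\<iota> r)) \<and>
     (\<forall>c q. \<iota> (c *\<^sub>R q) = ae_scale M c (\<iota> q)) \<and>
     continuous_map T (Linf_topology M) \<iota>"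

definition hypothesis_H ::
  "'a measure \<Rightarrow> ('a, complex) fclass set \<Rightarrow> 'a L2_map
     \<Rightarrow> ('q::real_vector \<Rightarrow> ('a, real) fclass) \<Rightarrow> bool" where
  "hypothesis_H M D L \<iota> \<longleftrightarrow>
     (\<forall>q z. let E = eigenspace M D (perturbed M L (\<iota> q)) z in
        eigenvalue M D (perturbed M L (\<iota> q)) z \<and> 2 \<le> L2_dim M E \<longrightarrow>
        (\<exists>\<sigma>. \<not> (\<exists>c::real. \<forall>u\<in>E.
            L2_proj M E (mult_op M (\<iota> \<sigma>) u) = ae_scale M (complex_of_real c) u)))"

end

(*
  If every multiplication by a test function compressed to an eigenspace E were a real scalar, then
  for u, v in E with u orthogonal to v the function u cnj v would be orthogonal to all test
  functions, and so would |u|^2 |v|_2^2 - |v|^2 |u|_2^2. Test functions separate integrable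
  functions (the boundary is a null set, and indicators of coordinate boxes are bounded limits of
  bump functions), so both vanish almost everywhere, and hence u = 0 or v = 0.
  E may be infinite-dimensional, so the orthogonal projection has to be constructed; it exists
  because self-adjointness makes E an orthogonal complement.
*)
theory Submission
  imports Defs
begin

section \<open>Bump functions\<close>

text \<open>The scalar by which a multiplication acts depends on the test function, so it has to
  cancel before orthogonality can be read off. In the pairing of u with v it multiplies the inner
  product 0; in the combination of squares it is common to both terms. The first identity then says
  that u and v live on disjoint sets, the second that they live on the same set. (H) speaks of the
  projection through a definite description, so an equation about it carries information only after
  existence and uniqueness are known. Since q is real, M_q is symmetric, and u lies in the kernel of
  L + M_q - z exactly when it is orthogonal to the range of L + M_q - cnj z. This comes straight
  from the graph identity of L and its adjoint, with z an arbitrary complex number. Separation by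
  test functions is proved one small coordinate box at a time and globalised by the Lindelof
  property, so no test function is ever patched together from several charts.\<close>

lemma Ck_on_subset: "Ck_on k W f \<Longrightarrow> W' \<subseteq> W \<Longrightarrow> Ck_on k W' f"
  by (induction k arbitrary: f) (auto intro: continuous_on_subset)

text \<open>Derivatives in \<open>Ck_on\<close> are taken in the full space, so agreement on
  \<open>W\<close> passes to them only because \<open>W\<close> is open.\<close>

lemma Ck_on_cong:
  assumes "open W" "\<And>x. x \<in> W \<Longrightarrow> f x = g x" "Ck_on k W f"
  shows "Ck_on k W g"
  using assms(2,3)
proof (induction k arbitrary: f g)
  case 0
  then show ?case by (simp cong: continuous_on_cong)
next
  case (Suc k)
  have der: "(g has_derivative frechet_derivative f (at x)) (at x)" if "x \<in> W" for x
  proof (rule has_derivative_transform_within_open)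
    show "(f has_derivative frechet_derivative f (at x)) (at x)"
      using Suc.prems(2) that by (simp add: frechet_derivative_works)
    show "open W" "x \<in> W" using assms(1) that by auto
  qed (use Suc.prems in auto)
  have eq: "frechet_derivative f (at x) = frechet_derivative g (at x)" if "x \<in> W" for x
    using der[OF that] by (rule frechet_derivative_at)
  have "Ck_on k W (\<lambda>x. frechet_derivative g (at x) v)" for v
  proof (rule Suc.IH)
    show "Ck_on k W (\<lambda>x. frechet_derivative f (at x) v)"
      using Suc.prems(2) by simp
    show "frechet_derivative f (at x) v = frechet_derivative g (at x) v" if "x \<in> W" for x
      by (simp only: eq[OF that])
  qed
  then show ?case
    using der by (auto simp: differentiable_def)
qed

text \<open>By uniqueness of the derivative, the chosen \<open>frechet_derivative\<close> can be
  replaced by an explicit formula. All closure properties below are proved through this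
  rule.\<close>

lemma Ck_on_SucI:
  assumes "open W" and der: "\<And>x. x \<in> W \<Longrightarrow> (f has_derivative f' x) (at x)"
    and "\<And>v. Ck_on k W (\<lambda>x. f' x v)"
  shows "Ck_on (Suc k) W f"
proof -
  have "Ck_on k W (\<lambda>x. frechet_derivative f (at x) v)" for v
    using assms(1) _ assms(3)[of v]
    by (rule Ck_on_cong) (use frechet_derivative_at[OF der] in auto)
  then show ?thesis
    using der by (auto simp: differentiable_def)
qed

text \<open>The product and chain rules leave undifferentiated factors, which the induction needs
  one order lower than they are given.\<close>

lemma Ck_on_SucD:
  assumes "Ck_on (Suc k) W f" shows "Ck_on k W f"
  using assms
proof (induction k arbitrary: f)
  case 0
  then show ?case
    by (auto intro!: continuous_at_imp_continuous_on differentiable_imp_continuous_within)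
next
  case (Suc k)
  have "Ck_on (Suc k) W (\<lambda>x. frechet_derivative f (at x) v)" for v
    using Suc.prems unfolding Ck_on.simps(2)[of "Suc k"] by blast
  then have "Ck_on k W (\<lambda>x. frechet_derivative f (at x) v)" for v
    using Suc.IH by blast
  then show ?case
    using Suc.prems unfolding Ck_on.simps(2) by blast
qed

lemma Ck_on_SucE:
  assumes "Ck_on (Suc k) W f"
  shows "\<And>x. x \<in> W \<Longrightarrow> (f has_derivative frechet_derivative f (at x)) (at x)"
    and "\<And>v. Ck_on k W (\<lambda>x. frechet_derivative f (at x) v)"
  using assms by (auto simp: frechet_derivative_works)

section \<open>Algebra and composition of C^k functions\<close>

lemma Ck_on_const: "Ck_on k W (\<lambda>x. c)"
  by (induction k arbitrary: c) auto

lemma Ck_on_bounded_linear: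
  assumes "bounded_linear L" "open W" "Ck_on k W f"
  shows "Ck_on k W (\<lambda>x. L (f x))"
  using assms(3)
proof (induction k arbitrary: f)
  case 0
  then show ?case
    by (auto intro!: bounded_linear.continuous_on[OF assms(1)])
next
  case (Suc k)
  note f = Ck_on_SucE[OF Suc.prems]
  show ?case
    by (rule Ck_on_SucI[OF assms(2), of _ "\<lambda>x v. L (frechet_derivative f (at x) v)"])
      (auto intro: bounded_linear.has_derivative[OF assms(1)] f Suc.IH)
qed

lemma Ck_on_linear:
  assumes "bounded_linear L" "open W"
  shows "Ck_on k W L"
proof (cases k)
  case 0
  then show ?thesis by (simp add: assms bounded_linear.linear linear_continuous_on)
next
  case (Suc j)
  show ?thesis unfolding Suc
    by (rule Ck_on_SucI[OF assms(2), of _ "\<lambda>x. L"])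
      (auto intro: bounded_linear_imp_has_derivative assms Ck_on_const)
qed

lemma Ck_on_add:
  assumes "open W" "Ck_on k W f" "Ck_on k W g"
  shows "Ck_on k W (\<lambda>x. f x + g x)"
  using assms(2,3)
proof (induction k arbitrary: f g)
  case 0
  then show ?case by (auto intro: continuous_on_add)
next
  case (Suc k)
  note f = Ck_on_SucE[OF Suc.prems(1)] and g = Ck_on_SucE[OF Suc.prems(2)]
  show ?case
    by (rule Ck_on_SucI[OF assms(1)], rule has_derivative_add[OF f(1) g(1)])
      (auto intro: f g Suc.IH)
qed

lemma Ck_on_sum:
  assumes "open W" "\<And>i. i \<in> I \<Longrightarrow> Ck_on k W (f i)"
  shows "Ck_on k W (\<lambda>x. \<Sum>i\<in>I. f i x)"
  using assms(2)
  by (induction I rule: infinite_finite_induct) (auto intro: Ck_on_const Ck_on_add[OF assms(1)])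

lemma Ck_on_scaleR:
  fixes a :: "'e::real_normed_vector \<Rightarrow> real"
  assumes "open W" "Ck_on k W a" "Ck_on k W f"
  shows "Ck_on k W (\<lambda>x. a x *\<^sub>R f x)"
  using assms(2,3)
proof (induction k arbitrary: a f)
  case 0
  then show ?case by (auto intro: continuous_on_scaleR)
next
  case (Suc k)
  note a = Ck_on_SucE[OF Suc.prems(1)] Ck_on_SucD[OF Suc.prems(1)]
    and f = Ck_on_SucE[OF Suc.prems(2)] Ck_on_SucD[OF Suc.prems(2)]
  show ?case
  proof (rule Ck_on_SucI[OF assms(1)])
    show "((\<lambda>x. a x *\<^sub>R f x) has_derivative (\<lambda>v. a x *\<^sub>R frechet_derivative f (at x) v +
        frechet_derivative a (at x) v *\<^sub>R f x)) (at x)" if "x \<in> W" for x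
      using has_derivative_scaleR[OF a(1) f(1)] that by blast
    show "Ck_on k W (\<lambda>x. a x *\<^sub>R frechet_derivative f (at x) v +
        frechet_derivative a (at x) v *\<^sub>R f x)" for v
      by (intro Ck_on_add[OF assms(1)] Suc.IH a f)
  qed
qed

lemma Ck_on_mult:
  fixes f g :: "'e::real_normed_vector \<Rightarrow> real"
  assumes "open W" "Ck_on k W f" "Ck_on k W g"
  shows "Ck_on k W (\<lambda>x. f x * g x)"
  using Ck_on_scaleR[OF assms] by simp

lemma Ck_on_prod:
  fixes f :: "'i \<Rightarrow> 'e::real_normed_vector \<Rightarrow> real"
  assumes "open W" "\<And>i. i \<in> I \<Longrightarrow> Ck_on k W (f i)"
  shows "Ck_on k W (\<lambda>x. \<Prod>i\<in>I. f i x)"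
  using assms(2)
  by (induction I rule: infinite_finite_induct) (auto intro: Ck_on_const Ck_on_mult[OF assms(1)])

text \<open>The derivative of \<open>g\<close> at \<open>F x\<close> is expanded over the basis of
  the intermediate Euclidean space. The chain rule becomes a finite sum of scalar C^k functions
  times fixed directional derivatives of \<open>g\<close> composed with \<open>F\<close>, and the
  induction hypothesis, with \<open>g\<close> arbitrary, covers the latter.\<close>

lemma Ck_on_compose:
  fixes g :: "'f::euclidean_space \<Rightarrow> 'g::real_normed_vector"
  assumes "open W" "open W'" "F ` W \<subseteq> W'" "Ck_on k W F" "Ck_on k W' g"
  shows "Ck_on k W (\<lambda>x. g (F x))"
  using assms(4,5)
proof (induction k arbitrary: g)
  case 0
  then show ?case
    using assms(3) by (auto intro: continuous_on_compose2)
next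
  case (Suc k)
  note F = Ck_on_SucE[OF Suc.prems(1)] Ck_on_SucD[OF Suc.prems(1)]
    and g = Ck_on_SucE[OF Suc.prems(2)]
  let ?F' = "\<lambda>x. frechet_derivative F (at x)" and ?g' = "\<lambda>y. frechet_derivative g (at y)"
  show ?case
  proof (rule Ck_on_SucI[OF assms(1), of _ "\<lambda>x v. \<Sum>b\<in>Basis. (?F' x v \<bullet> b) *\<^sub>R ?g' (F x) b"])
    fix x assume x: "x \<in> W"
    then have Fx: "F x \<in> W'" using assms(3) by auto
    have lin: "linear (?g' (F x))"
      using g(1)[OF Fx] has_derivative_linear by blast
    have 1: "((\<lambda>x. g (F x)) has_derivative (\<lambda>v. ?g' (F x) (?F' x v))) (at x)"
      using has_derivative_compose[OF F(1)[OF x] g(1)[OF Fx]] .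
    have *: "?g' (F x) y = (\<Sum>b\<in>Basis. (y \<bullet> b) *\<^sub>R ?g' (F x) b)" for y
    proof -
      have "?g' (F x) (\<Sum>b\<in>Basis. (y \<bullet> b) *\<^sub>R b) = (\<Sum>b\<in>Basis. (y \<bullet> b) *\<^sub>R ?g' (F x) b)"
        by (simp add: linear_sum[OF lin] linear_cmul[OF lin])
      then show ?thesis by (simp add: euclidean_representation)
    qed
    have "(\<lambda>v. ?g' (F x) (?F' x v)) = (\<lambda>v. \<Sum>b\<in>Basis. (?F' x v \<bullet> b) *\<^sub>R ?g' (F x) b)"
      by (rule ext) (rule *)
    with 1 show "((\<lambda>x. g (F x)) has_derivative
        (\<lambda>v. \<Sum>b\<in>Basis. (?F' x v \<bullet> b) *\<^sub>R ?g' (F x) b)) (at x)"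
      by (rule has_derivative_eq_rhs)
  next
    fix v
    show "Ck_on k W (\<lambda>x. \<Sum>b\<in>Basis. (?F' x v \<bullet> b) *\<^sub>R ?g' (F x) b)"
      by (intro Ck_on_sum Ck_on_scaleR assms(1) Suc.IH F(3) g(2)
          Ck_on_bounded_linear[OF bounded_linear_inner_left] F(2))
  qed
qed

text \<open>The derivatives of \<open>exp (- 1 / t)\<close> stay in this family, which is what makes the
  induction on the order of differentiability work.\<close>

definition exp_flat :: "real poly \<Rightarrow> real \<Rightarrow> real" where
  "exp_flat p t = (if t > 0 then poly p (1 / t) * exp (- 1 / t) else 0)"

text \<open>From the right, y = 1/t goes to infinity and exp(-y) beats every polynomial in y; from
  the left the function is identically 0.\<close>

lemma exp_flat_at_0: "((\<lambda>t. exp_flat p t) \<longlongrightarrow> 0) (at 0)"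
proof -
  have "((\<lambda>y. poly p y * exp (- y)) \<longlongrightarrow> 0) at_top"
  proof -
    have "((\<lambda>y. \<Sum>i\<le>degree p. coeff p i * (y ^ i * exp (- y))) \<longlongrightarrow> (\<Sum>i\<le>degree p. coeff p i * 0)) at_top"
    proof (intro tendsto_sum tendsto_mult tendsto_const)
      fix i
      show "((\<lambda>y::real. y ^ i * exp (- y)) \<longlongrightarrow> 0) at_top"
        using tendsto_power_div_exp_0[of i] by (simp add: exp_minus divide_inverse)
    qed
    then show ?thesis by (simp add: poly_altdef sum_distrib_right mult.assoc)
  qed
  from filterlim_compose[OF this filterlim_inverse_at_top_right]
  have "((\<lambda>t. exp_flat p t) \<longlongrightarrow> 0) (at_right 0)"
  proof (rule Lim_transform_eventually)
    show "\<forall>\<^sub>F t in at_right 0. poly p (inverse t) * exp (- inverse t) = exp_flat p t"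
      using eventually_at_right_less[of "0::real"]
      by eventually_elim (simp add: exp_flat_def inverse_eq_divide)
  qed
  moreover have "((\<lambda>t. exp_flat p t) \<longlongrightarrow> 0) (at_left 0)"
  proof (rule Lim_transform_eventually[OF tendsto_const])
    show "\<forall>\<^sub>F t in at_left 0. 0 = exp_flat p t"
      using eventually_at_left_real[of "-1" "0::real"]
      by (rule eventually_mono) (auto simp: exp_flat_def)
  qed
  ultimately show ?thesis by (simp add: filterlim_split_at)
qed

text \<open>With s = 1/t one has ds/dt = -s^2, so p(s) exp(-s) has t-derivative s^2 (p(s) - p'(s))
  exp(-s). The factor \<open>[:0, 0, 1:]\<close> is this s^2.\<close>

lemma exp_flat_deriv:
  "(exp_flat p has_real_derivative exp_flat ([:0, 0, 1:] * (p - pderiv p)) t) (at t)"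
proof -
  let ?p = "[:0, 0, 1:] * (p - pderiv p)"
  consider "t > 0" | "t < 0" | "t = 0" by linarith
  then show ?thesis
  proof cases
    case 1
    have "((\<lambda>t. poly p (1 / t) * exp (- 1 / t)) has_real_derivative exp_flat ?p t) (at t)"
      using 1 by (auto intro!: derivative_eq_intros DERIV_chain2[OF poly_DERIV]
          simp: exp_flat_def field_simps power2_eq_square)
    then show ?thesis
      by (rule has_field_derivative_transform_within_open[of _ _ _ "{0<..}"])
        (use 1 in \<open>auto simp: exp_flat_def\<close>)
  next
    case 2
    have "((\<lambda>t. 0) has_real_derivative exp_flat ?p t) (at t)"
      using 2 by (simp add: exp_flat_def)
    then show ?thesis
      by (rule has_field_derivative_transform_within_open[of _ _ _ "{..<0}"])
        (use 2 in \<open>auto simp: exp_flat_def\<close>)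
  next
    case 3
    \<comment> \<open>Dividing by h multiplies the polynomial in 1/h by its variable, so the
      difference quotient at 0 is again in the family and has limit 0.\<close>
    have "(\<lambda>h. (exp_flat p (0 + h) - exp_flat p 0) / h) = exp_flat ([:0, 1:] * p)"
      by (auto simp: exp_flat_def fun_eq_iff)
    then have "(exp_flat p has_real_derivative 0) (at 0)"
      using exp_flat_at_0[of "[:0, 1:] * p"] unfolding DERIV_def by simp
    then show ?thesis using 3 by (simp add: exp_flat_def)
  qed
qed

lemma Ck_on_exp_flat: "Ck_on k UNIV (exp_flat p)"
proof (induction k arbitrary: p)
  case 0
  then show ?case
    using exp_flat_deriv by (auto intro!: continuous_at_imp_continuous_on DERIV_isCont)
next
  case (Suc k)
  \<comment> \<open>The direction \<open>v\<close> of differentiation is absorbed into the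
    polynomial, which keeps the directional derivative in the family covered by the induction
    hypothesis.\<close>
  have eq: "exp_flat p t * v = exp_flat (smult v p) t" for p t v
    by (simp add: exp_flat_def)
  show ?case
  proof (rule Ck_on_SucI[OF open_UNIV])
    show "(exp_flat p has_derivative (*) (exp_flat ([:0, 0, 1:] * (p - pderiv p)) t)) (at t)" for t
      using exp_flat_deriv unfolding has_field_derivative_def .
    show "Ck_on k UNIV (\<lambda>t. exp_flat ([:0, 0, 1:] * (p - pderiv p)) t * v)" for v
      unfolding eq by (rule Suc.IH)
  qed
qed

text \<open>Scaling by \<open>Suc m\<close> sends each positive argument to infinity, where
  exp(-1/t) tends to 1, while the set of zeros stays the complement of the box for every
  \<open>m\<close>.\<close>

definition box_bump :: "nat \<Rightarrow> 'e::euclidean_space \<Rightarrow> 'e \<Rightarrow> 'e \<Rightarrow> real" where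
  "box_bump m c d x = (\<Prod>b\<in>Basis.
     exp_flat 1 (real (Suc m) * ((x - c) \<bullet> b)) * exp_flat 1 (real (Suc m) * ((d - x) \<bullet> b)))"

lemma Ck_on_box_bump: "Ck_on k UNIV (box_bump m c (d :: 'e::euclidean_space))"
proof -
  have 1: "Ck_on k UNIV (\<lambda>x::'e. real (Suc m) * ((x - c) \<bullet> b))" for b
  proof -
    have "Ck_on k UNIV (\<lambda>x::'e. (real (Suc m) *\<^sub>R b) \<bullet> x + - (real (Suc m) * (c \<bullet> b)))"
      by (intro Ck_on_add Ck_on_linear Ck_on_const open_UNIV bounded_linear_inner_right)
    then show ?thesis by (simp add: algebra_simps inner_commute)
  qed
  have 2: "Ck_on k UNIV (\<lambda>x::'e. real (Suc m) * ((d - x) \<bullet> b))" for b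
  proof -
    have "Ck_on k UNIV (\<lambda>x::'e. (- real (Suc m) *\<^sub>R b) \<bullet> x + real (Suc m) * (d \<bullet> b))"
      by (intro Ck_on_add Ck_on_linear Ck_on_const open_UNIV bounded_linear_inner_right)
    then show ?thesis by (simp add: algebra_simps inner_commute)
  qed
  show ?thesis unfolding box_bump_def[abs_def]
    by (intro Ck_on_prod Ck_on_mult open_UNIV
        Ck_on_compose[OF open_UNIV open_UNIV subset_UNIV _ Ck_on_exp_flat] 1 2)
qed

lemma exp_flat_1_bounds: "0 \<le> exp_flat 1 t" "exp_flat 1 t \<le> 1"
  by (auto simp: exp_flat_def)

lemma box_bump_bounds: "0 \<le> box_bump m c d x" "box_bump m c d x \<le> 1"
  unfolding box_bump_def
  by (auto intro!: prod_nonneg prod_le_1 mult_nonneg_nonneg mult_le_one exp_flat_1_bounds)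

lemma box_bump_eq_0: "x \<notin> box c d \<Longrightarrow> box_bump m c d x = 0"
  by (auto simp: box_bump_def mem_box exp_flat_def inner_diff_left zero_less_mult_iff)

lemma box_bump_tendsto: "(\<lambda>m. box_bump m c d x) \<longlonglongrightarrow> indicator (box c d) x"
proof (cases "x \<in> box c d")
  case True
  have lim: "(\<lambda>m. exp_flat 1 (real (Suc m) * s)) \<longlonglongrightarrow> 1" if "s > 0" for s
  proof -
    have "(\<lambda>m. exp (- (1 / s) * inverse (real (Suc m)))) \<longlonglongrightarrow> exp (- (1 / s) * 0)"
      by (intro tendsto_intros LIMSEQ_inverse_real_of_nat)
    moreover have "exp (- (1 / s) * inverse (real (Suc m))) = exp_flat 1 (real (Suc m) * s)" for m
      using that by (simp add: exp_flat_def divide_simps)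
    ultimately show ?thesis by simp
  qed
  have "(\<lambda>m. box_bump m c d x) \<longlonglongrightarrow> (\<Prod>b\<in>(Basis::'a set). 1 * 1)"
    unfolding box_bump_def using True
    by (intro tendsto_prod tendsto_mult lim) (auto simp: mem_box inner_diff_left)
  then show ?thesis using True by simp
next
  case False
  then show ?thesis by (simp add: box_bump_eq_0)
qed

lemma continuous_on_box_bump: "continuous_on S (box_bump m c d)"
  using Ck_on_box_bump[of 0 m c d] by (auto intro: continuous_on_subset)

section \<open>Test functions separate integrable functions\<close>

text \<open>Continuity of the local extension at a point restricts to the relative topology of
  \<open>S\<close>; images of boundary charts are not open, so the relative version is the one
  required.\<close>

lemma smooth_on_imp_continuous_on:
  assumes "smooth_on S f"
  shows "continuous_on S f"
  unfolding continuous_on_def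
proof
  fix x assume x: "x \<in> S"
  obtain W F where "open W \<and> x \<in> W \<and> (\<forall>k. Ck_on k W F) \<and> (\<forall>y\<in>S \<inter> W. F y = f y)"
    using bspec[OF assms[unfolded smooth_on_def] x] by auto
  then have W: "open W" "x \<in> W" "\<And>k. Ck_on k W F" "\<And>y. y \<in> S \<Longrightarrow> y \<in> W \<Longrightarrow> F y = f y"
    by simp_all
  have "continuous_on W F" using W(3)[of 0] by simp
  then have "isCont F x"
    using continuous_on_eq_continuous_at[OF W(1)] W(2) by blast
  then have "(F \<longlongrightarrow> F x) (at x within S)"
    unfolding isCont_def by (rule tendsto_within_subset) (rule subset_UNIV)
  then have "(F \<longlongrightarrow> f x) (at x within S)"
    using W(2,4) x by simp
  moreover have "\<forall>\<^sub>F y in at x within S. F y = f y"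
    unfolding eventually_at_topological using W by blast
  ultimately show "(f \<longlongrightarrow> f x) (at x within S)"
    by (rule Lim_transform_eventually)
qed

section \<open>Charts and extension of coordinate functions by zero\<close>

lemma closed_coord_space: "closed (coord_space n)"
  by (simp add: coord_space_def)

lemma coord_halfspace_subset: "coord_halfspace n \<subseteq> coord_space n"
  by (auto simp: coord_halfspace_def)

lemma closed_coord_halfspace: "closed (coord_halfspace n)"
proof -
  have "coord_halfspace n = coord_space n \<inter> {x. 0 \<le> x \<bullet> (SOME b. b \<in> Basis)}"
    by (auto simp: coord_halfspace_def)
  then show ?thesis
    by (metis closed_Int closed_coord_space closed_halfspace_component_ge inner_commute)
qed

lemma enn2real_eq_imp_eq:
  "enn2real a = enn2real b \<Longrightarrow> a \<noteq> \<infinity> \<Longrightarrow> b \<noteq> \<infinity> \<Longrightarrow> a = b"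
  by (metis ennreal_enn2real_if infinity_ennreal_def)

context
  fixes n :: nat and \<A> :: "('a::{t2_space, second_countable_topology}, 'e::euclidean_space) chart set"
  assumes manifold: "smooth_manifold_with_boundary n \<A>"
begin

text \<open>A chart image is relatively open in a closed model space, hence the intersection of a
  closed and an open set, hence Borel even at the boundary.\<close>

lemma chart_props:
  assumes "(U, \<phi>) \<in> \<A>"
  shows "open U" "homeomorphism U (\<phi> ` U) \<phi> (inv_into U \<phi>)"
    "\<phi> ` U \<subseteq> coord_space n" "\<phi> ` U \<in> sets borel"
proof -
  have c: "is_chart n (U, \<phi>)"
    using manifold assms by (auto simp: smooth_manifold_with_boundary_def)
  then show "open U" "homeomorphism U (\<phi> ` U) \<phi> (inv_into U \<phi>)"
    by (auto simp: is_chart_def)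
  from c consider "openin (top_of_set (coord_space n)) (\<phi> ` U)"
    | "openin (top_of_set (coord_halfspace n)) (\<phi> ` U)"
    by (auto simp: is_chart_def)
  then have "\<phi> ` U \<subseteq> coord_space n \<and> \<phi> ` U \<in> sets borel"
  proof cases
    case 1
    then obtain T where T: "open T" "\<phi> ` U = coord_space n \<inter> T"
      unfolding openin_open by auto
    then show ?thesis
      using sets.Int[OF borel_closed[OF closed_coord_space] borel_open[OF T(1)], of n] T(2) by auto
  next
    case 2
    then obtain T where T: "open T" "\<phi> ` U = coord_halfspace n \<inter> T"
      unfolding openin_open by auto
    then show ?thesis
      using coord_halfspace_subset[of n] sets.Int[OF borel_closed[OF closed_coord_halfspace] borel_open[OF T(1)], of n] T(2)
      by auto
  qed
  then show "\<phi> ` U \<subseteq> coord_space n" "\<phi> ` U \<in> sets borel" by auto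
qed

lemma smooth_transition:
  assumes "(U, \<phi>) \<in> \<A>" "(V, \<psi>) \<in> \<A>"
  shows "smooth_on (\<psi> ` (V \<inter> U)) (\<phi> \<circ> inv_into V \<psi>)"
  using manifold assms by (auto simp: smooth_manifold_with_boundary_def)

definition chart_extend :: "'a set \<Rightarrow> ('a \<Rightarrow> 'e) \<Rightarrow> ('e \<Rightarrow> real) \<Rightarrow> 'a \<Rightarrow> real" where
  "chart_extend U \<phi> g p = (if p \<in> U then g (\<phi> p) else 0)"

text \<open>The inverse chart is continuous on the part of the closed box lying in the model space,
  all of which is in the chart image, and carries it onto the preimage.\<close>

lemma compact_chart_preimage:
  assumes chart: "(U, \<phi>) \<in> \<A>" and sub: "cbox a b \<inter> coord_space n \<subseteq> \<phi> ` U"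
  shows "compact {p \<in> U. \<phi> p \<in> cbox a b}"
proof -
  note props = chart_props[OF chart]
  have "{p \<in> U. \<phi> p \<in> cbox a b} = inv_into U \<phi> ` (cbox a b \<inter> coord_space n)"
    using props(2,3) sub by (auto simp: homeomorphism_def image_iff) (metis IntI image_subset_iff)+
  moreover have "compact (cbox a b \<inter> coord_space n)"
    by (simp add: closed_coord_space compact_Int_closed)
  ultimately show ?thesis
    using homeomorphism_cont2[OF props(2)] sub continuous_on_subset compact_continuous_image by metis
qed

text \<open>The support lies in the compact set \<open>K\<close>, which is closed because the
  manifold is Hausdorff. Near points of \<open>U\<close> the function is \<open>g\<close> after a
  transition map; a point outside \<open>U\<close> has the open neighbourhood \<open>- K\<close>,
  where the function is 0.\<close>

lemma smooth_chart_extend: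
  assumes chart: "(U, \<phi>) \<in> \<A>" and sub: "cbox a b \<inter> coord_space n \<subseteq> \<phi> ` U"
    and g: "\<And>k. Ck_on k UNIV g" "\<And>x. x \<notin> cbox a b \<Longrightarrow> g x = 0"
  shows "smooth_fun \<A> (chart_extend U \<phi> g)"
  unfolding smooth_fun_def
proof clarify
  fix V \<psi> assume V: "(V, \<psi>) \<in> \<A>"
  note Vp = chart_props[OF V] and Up = chart_props[OF chart]
  note inv = homeomorphism_apply1[OF Vp(2)]
  define K where "K = {p \<in> U. \<phi> p \<in> cbox a b}"
  have K: "closed K" "K \<subseteq> U"
    using compact_chart_preimage[OF chart sub] compact_imp_closed by (auto simp: K_def)
  have image_open: "\<exists>W. open W \<and> \<psi> ` (V \<inter> S) = \<psi> ` V \<inter> W" if "open S" for S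
    using homeomorphism_imp_open_map[OF Vp(2), of "V \<inter> S"] that
    by (auto simp: openin_open)
  show "smooth_on (\<psi> ` V) (chart_extend U \<phi> g \<circ> inv_into V \<psi>)"
    unfolding smooth_on_def
  proof
    fix y assume "y \<in> \<psi> ` V"
    then obtain p where p: "p \<in> V" "y = \<psi> p" by blast
    show "\<exists>W F. open W \<and> y \<in> W \<and> (\<forall>k. Ck_on k W F) \<and>
      (\<forall>z\<in>\<psi> ` V \<inter> W. F z = (chart_extend U \<phi> g \<circ> inv_into V \<psi>) z)"
    proof (cases "p \<in> U")
      case True
      then have y: "y \<in> \<psi> ` (V \<inter> U)" using p by blast
      obtain W F where "open W \<and> y \<in> W \<and> (\<forall>k. Ck_on k W F) \<and>
          (\<forall>z\<in>\<psi> ` (V \<inter> U) \<inter> W. F z = (\<phi> \<circ> inv_into V \<psi>) z)"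
        using bspec[OF smooth_transition[OF chart V, unfolded smooth_on_def] y] by auto
      then have W: "open W" "y \<in> W" "\<And>k. Ck_on k W F"
        and F: "\<And>z. z \<in> \<psi> ` (V \<inter> U) \<Longrightarrow> z \<in> W \<Longrightarrow> F z = (\<phi> \<circ> inv_into V \<psi>) z"
        by simp_all
      \<comment> \<open>\<open>F\<close> agrees with the transition map only on the image of
        \<open>V \<inter> U\<close>. That image is relatively open, and cutting down to
        \<open>W'\<close> excludes all other points of the chart image.\<close>
      obtain W' where W': "open W'" "\<psi> ` (V \<inter> U) = \<psi> ` V \<inter> W'"
        using image_open[OF Up(1)] by blast
      have "Ck_on k (W \<inter> W') (\<lambda>z. g (F z))" for k
        by (rule Ck_on_compose[OF _ open_UNIV subset_UNIV Ck_on_subset[OF W(3)] g(1)])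
          (use W(1) W'(1) in auto)
      moreover have "g (F z) = (chart_extend U \<phi> g \<circ> inv_into V \<psi>) z" if z: "z \<in> \<psi> ` V \<inter> (W \<inter> W')" for z
      proof -
        have z': "z \<in> \<psi> ` (V \<inter> U)" using z W'(2) by blast
        then obtain q where "q \<in> V" "q \<in> U" "z = \<psi> q" by blast
        then show ?thesis using F[of z] z z' by (simp add: chart_extend_def inv)
      qed
      moreover have "y \<in> W \<inter> W'" using W(2) W'(2) y by blast
      moreover have "open (W \<inter> W')" using W(1) W'(1) by blast
      ultimately show ?thesis by (intro exI[of _ "W \<inter> W'"] exI[of _ "\<lambda>z. g (F z)"] conjI allI ballI) (assumption+)
    next
      case False
      obtain W where W: "open W" "\<psi> ` (V \<inter> - K) = \<psi> ` V \<inter> W"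
        using image_open[of "- K"] K(1) by auto
      have "0 = (chart_extend U \<phi> g \<circ> inv_into V \<psi>) z" if z: "z \<in> \<psi> ` V \<inter> W" for z
      proof -
        obtain q where "q \<in> V" "q \<notin> K" "z = \<psi> q" using z W(2) by blast
        then show ?thesis using g(2) by (auto simp: chart_extend_def inv K_def)
      qed
      moreover have "y \<in> W" using p False K(2) W(2) by blast
      ultimately show ?thesis
        using W(1) by (intro exI[of _ W] exI[of _ "\<lambda>z. 0"]) (simp add: Ck_on_const)
    qed
  qed
qed

text \<open>Having \<open>W\<close> open in the full coordinate space, not merely in the half-space,
  is what keeps the support inside the manifold interior.\<close>

lemma chart_extend_in_Cc:
  assumes chart: "(U, \<phi>) \<in> \<A>"
    and W: "openin (top_of_set (coord_space n)) W" "W \<subseteq> \<phi> ` U" "cbox a b \<inter> coord_space n \<subseteq> W"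
    and g: "\<And>k. Ck_on k UNIV g" "\<And>x. x \<notin> cbox a b \<Longrightarrow> g x = 0"
  shows "chart_extend U \<phi> g \<in> Cc_infty_interior n \<A>"
proof -
  have sub: "cbox a b \<inter> coord_space n \<subseteq> \<phi> ` U" using W by blast
  let ?K = "{p \<in> U. \<phi> p \<in> cbox a b}" and ?S = "{p. chart_extend U \<phi> g p \<noteq> 0}"
  have K: "compact ?K" by (rule compact_chart_preimage[OF chart sub])
  have "?S \<subseteq> ?K" using g(2) by (auto simp: chart_extend_def)
  then have cl: "closure ?S \<subseteq> ?K"
    using compact_imp_closed[OF K] by (rule closure_minimal)
  have "?K \<subseteq> manifold_interior n \<A>"
  proof
    fix p assume "p \<in> ?K"
    then have "p \<in> U" "\<phi> p \<in> W" using W(3) chart_props(3)[OF chart] by auto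
    then show "p \<in> manifold_interior n \<A>"
      unfolding manifold_interior_def using chart W(1,2) by (auto intro!: bexI[OF _ chart])
  qed
  moreover have "compact (closure ?S)"
    using compact_Int_closed[OF K closed_closure[of ?S]] cl by (simp add: Int_absorb1)
  ultimately show ?thesis
    using smooth_chart_extend[OF chart sub g] cl by (auto simp: Cc_infty_interior_def)
qed

text \<open>The measures \<open>w\<^sup>+ d\<mu>\<close> and \<open>w\<^sup>- d\<mu>\<close>, restricted to the preimage of a small box and pushed to
  coordinates, agree on the \<open>\<pi>\<close>-system of boxes, because the indicator of a box is a
  bounded pointwise limit of bump functions.\<close>

lemma AE_nonpos_on_chart_box:
  fixes w :: "'a \<Rightarrow> real"
  assumes chart: "(U, \<phi>) \<in> \<A>"
    and W: "openin (top_of_set (coord_space n)) W" "W \<subseteq> \<phi> ` U" "cbox a b \<inter> coord_space n \<subseteq> W"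
    and sets[measurable_cong]: "sets \<mu> = sets borel"
    and w: "integrable \<mu> w"
    and orth: "\<And>f. f \<in> Cc_infty_interior n \<A> \<Longrightarrow> (LINT p|\<mu>. f p * w p) = 0"
  shows "AE p in \<mu>. p \<in> U \<longrightarrow> \<phi> p \<in> box a b \<longrightarrow> w p \<le> 0"
proof -
  note Up = chart_props[OF chart]
  note cont = homeomorphism_cont1[OF Up(2)]
  have w_meas[measurable]: "w \<in> borel_measurable \<mu>" using w by simp
  \<comment> \<open>The chart is continued by 0 outside \<open>U\<close> to be measurable on the
    whole manifold. The preimages \<open>V c d\<close> are therefore intersected with
    \<open>U\<close>, as a box may contain 0.\<close>
  define \<Phi> where "\<Phi> p = indicator U p *\<^sub>R \<phi> p" for p
  have \<Phi>[measurable]: "\<Phi> \<in> borel_measurable \<mu>"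
    unfolding \<Phi>_def[abs_def] measurable_cong_sets[OF sets refl]
    using Up(1) cont by (intro borel_measurable_continuous_on_indicator) auto
  have U[measurable]: "U \<in> sets \<mu>" using Up(1) sets by auto
  define V where "V c d = U \<inter> \<Phi> -` box c d" for c d
  have V[measurable]: "V c d \<in> sets \<mu>" for c d
    using measurable_sets[OF \<Phi>, of "box c d"] sets.Int[OF U] sets_eq_imp_space_eq[OF sets]
    by (simp add: V_def)
  have int0: "(LINT p|\<mu>. w p * indicator (V c d) p) = 0" if cd: "box c d \<subseteq> box a b" for c d
  proof -
    let ?f = "\<lambda>m. chart_extend U \<phi> (box_bump m c d)"
    have f: "?f m \<in> Cc_infty_interior n \<A>" for m
      by (rule chart_extend_in_Cc[OF chart W Ck_on_box_bump])
        (use cd box_subset_cbox box_bump_eq_0 in blast)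
    have f_eq: "?f m p = indicator U p * box_bump m c d (\<Phi> p)" for m p
      by (auto simp: chart_extend_def \<Phi>_def)
    have [measurable]: "box_bump m c d \<in> borel_measurable borel" for m
      by (rule borel_measurable_continuous_onI[OF continuous_on_box_bump])
    have "(\<lambda>m. LINT p|\<mu>. ?f m p * w p) \<longlonglongrightarrow> (LINT p|\<mu>. indicator (V c d) p * w p)"
    proof (rule integral_dominated_convergence[where w = "\<lambda>p. norm (w p)"])
      show "integrable \<mu> (\<lambda>p. norm (w p))" using w by simp
      show "(\<lambda>p. ?f m p * w p) \<in> borel_measurable \<mu>" for m
        unfolding f_eq by measurable
      show "AE p in \<mu>. (\<lambda>m. ?f m p * w p) \<longlonglongrightarrow> indicator (V c d) p * w p"
      proof (rule AE_I2)
        fix p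
        have "(\<lambda>m. indicator U p * box_bump m c d (\<Phi> p)) \<longlonglongrightarrow> indicator U p * indicator (box c d) (\<Phi> p)"
          by (intro tendsto_intros box_bump_tendsto)
        moreover have "indicator U p * indicator (box c d) (\<Phi> p) = (indicator (V c d) p :: real)"
          by (simp add: V_def indicator_def)
        ultimately show "(\<lambda>m. ?f m p * w p) \<longlonglongrightarrow> indicator (V c d) p * w p"
          unfolding f_eq by (intro tendsto_mult_right) simp
      qed
      show "AE p in \<mu>. norm (?f m p * w p) \<le> norm (w p)" for m
        using box_bump_bounds[of m c d]
        by (auto simp: f_eq abs_mult indicator_def intro!: mult_left_le_one_le)
    qed measurable
    then have "(\<lambda>m::nat. 0::real) \<longlonglongrightarrow> (LINT p|\<mu>. indicator (V c d) p * w p)"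
      using orth[OF f] by simp
    then show ?thesis by (simp add: LIMSEQ_const_iff mult.commute)
  qed
  \<comment> \<open>\<open>ennreal\<close> sends negative reals to 0, so \<open>s = 1\<close> yields
    the positive part of \<open>w\<close> and \<open>s = - 1\<close> the negative part.\<close>
  define \<nu> where "\<nu> s = distr (density \<mu> (\<lambda>p. ennreal (s * w p) * indicator (V a b) p)) borel \<Phi>" for s :: real
  have [measurable]: "\<Phi> \<in> measurable (density \<mu> f) borel" for f
    by simp
  have \<nu>: "emeasure (\<nu> s) B = (\<integral>\<^sup>+p. ennreal (s * w p) * indicator (V a b) p * indicator (\<Phi> -` B) p \<partial>\<mu>)"
    if B[measurable]: "B \<in> sets borel" for s B
  proof -
    have sp: "space \<mu> = UNIV" using sets_eq_imp_space_eq[OF sets] by simp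
    have [measurable]: "\<Phi> -` B \<in> sets \<mu>"
      using measurable_sets[OF \<Phi> B] sp by simp
    have "emeasure (\<nu> s) B = emeasure (density \<mu> (\<lambda>p. ennreal (s * w p) * indicator (V a b) p)) (\<Phi> -` B)"
      unfolding \<nu>_def by (subst emeasure_distr) (auto simp: sp)
    also have "\<dots> = (\<integral>\<^sup>+p. ennreal (s * w p) * indicator (V a b) p * indicator (\<Phi> -` B) p \<partial>\<mu>)"
      by (subst emeasure_density) auto
    finally show ?thesis .
  qed
  have \<nu>_box: "emeasure (\<nu> s) (box c d) = (\<integral>\<^sup>+p. ennreal (s * (w p * indicator (V c' d') p)) \<partial>\<mu>)"
    if "box a b \<inter> box c d = box c' d'" for s c d c' d'
    unfolding \<nu>[OF borel_open[OF open_box]]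
    by (rule nn_integral_cong) (use that in \<open>auto simp: V_def indicator_def\<close>)
  have fin: "(\<integral>\<^sup>+p. ennreal (w p * indicator (V c d) p) \<partial>\<mu>) \<noteq> \<infinity>"
    "(\<integral>\<^sup>+p. ennreal (- (w p * indicator (V c d) p)) \<partial>\<mu>) \<noteq> \<infinity>" for c d
    using integrable_real_mult_indicator[OF V w] unfolding real_integrable_def by auto
  have \<nu>_eq: "emeasure (\<nu> 1) (box c d) = emeasure (\<nu> (- 1)) (box c d)"
    and \<nu>_fin: "emeasure (\<nu> 1) (box c d) \<noteq> \<infinity>" for c d
  proof -
    \<comment> \<open>Bumps are available only inside \<open>box a b\<close>, but these measures see
      a box only through its intersection with \<open>box a b\<close>, which is again a box.\<close>
    obtain c' d' where cd: "box a b \<inter> box c d = box c' d'"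
      using box_Int_box by blast
    then have "(LINT p|\<mu>. w p * indicator (V c' d') p) = 0"
      by (intro int0) blast
    then have "enn2real (\<integral>\<^sup>+p. ennreal (w p * indicator (V c' d') p) \<partial>\<mu>) =
        enn2real (\<integral>\<^sup>+p. ennreal (- (w p * indicator (V c' d') p)) \<partial>\<mu>)"
      using real_lebesgue_integral_def[OF integrable_real_mult_indicator[OF V w]] by simp
    then have "(\<integral>\<^sup>+p. ennreal (w p * indicator (V c' d') p) \<partial>\<mu>) =
        (\<integral>\<^sup>+p. ennreal (- (w p * indicator (V c' d') p)) \<partial>\<mu>)"
      by (intro enn2real_eq_imp_eq fin)
    then show "emeasure (\<nu> 1) (box c d) = emeasure (\<nu> (- 1)) (box c d)"
      "emeasure (\<nu> 1) (box c d) \<noteq> \<infinity>"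
      unfolding \<nu>_box[OF cd] using fin(1)[of c' d'] by auto
  qed
  have "\<nu> 1 = \<nu> (- 1)"
  proof (rule measure_eqI_generator_eq)
    let ?E = "range (\<lambda>(a, b). box a b::'e set)"
    show "Int_stable ?E"
      by (auto simp: Int_stable_def box_Int_box)
    show "?E \<subseteq> Pow UNIV" "sets (\<nu> 1) = sigma_sets UNIV ?E" "sets (\<nu> (- 1)) = sigma_sets UNIV ?E"
      by (simp_all add: borel_eq_box \<nu>_def)
    let ?A = "\<lambda>n::nat. box (- (real n *\<^sub>R One)) (real n *\<^sub>R One) :: 'e set"
    show "range ?A \<subseteq> ?E" "(\<Union>i. ?A i) = UNIV"
      unfolding UN_box_eq_UNIV by auto
    show "emeasure (\<nu> 1) (?A i) \<noteq> \<infinity>" for i by (rule \<nu>_fin)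
    show "emeasure (\<nu> 1) X = emeasure (\<nu> (- 1)) X" if "X \<in> ?E" for X
      using that \<nu>_eq by auto
  qed
  define P where "P = {p. 0 < w p}"
  have P: "P \<in> sets borel"
    using w_meas unfolding P_def measurable_cong_sets[OF sets refl] by simp
  \<comment> \<open>A set to separate the two measures: the negative part of \<open>w\<close>
    vanishes over \<open>B\<close> and the positive part lives there. Equality of the measures then
    forces the positive part to have integral 0.\<close>
  define B where "B = \<phi> ` (U \<inter> P)"
  \<comment> \<open>By injectivity of the chart, this image is a preimage under the continuous
    inverse chart.\<close>
  have "B \<in> sets borel"
  proof -
    have "inv_into U \<phi> \<in> borel_measurable (restrict_space borel (\<phi> ` U))"
      by (rule borel_measurable_continuous_on_restrict[OF homeomorphism_cont2[OF Up(2)]])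
    from measurable_sets[OF this P]
    have "inv_into U \<phi> -` P \<inter> \<phi> ` U \<in> sets borel"
      using Up(4) by (auto simp: space_restrict_space sets_restrict_space_iff)
    moreover have "inv_into U \<phi> -` P \<inter> \<phi> ` U = B"
      using homeomorphism_apply1[OF Up(2)] by (auto simp: B_def)
    ultimately show ?thesis by simp
  qed
  have inB: "\<Phi> p \<in> B \<longleftrightarrow> p \<in> P" if "p \<in> U" for p
    using that homeomorphism_apply1[OF Up(2)] by (auto simp: B_def \<Phi>_def) (metis)
  have "emeasure (\<nu> (- 1)) B = (\<integral>\<^sup>+p. 0 \<partial>\<mu>)"
    unfolding \<nu>[OF \<open>B \<in> sets borel\<close>]
    by (rule nn_integral_cong) (auto simp: V_def inB P_def indicator_def ennreal_neg)
  then have "emeasure (\<nu> 1) B = 0" using \<open>\<nu> 1 = \<nu> (- 1)\<close> by simp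
  moreover have "emeasure (\<nu> 1) B = (\<integral>\<^sup>+p. ennreal (w p) * indicator (V a b) p \<partial>\<mu>)"
    unfolding \<nu>[OF \<open>B \<in> sets borel\<close>]
    by (rule nn_integral_cong) (auto simp: V_def inB P_def indicator_def ennreal_neg)
  ultimately have "(\<integral>\<^sup>+p. ennreal (w p) * indicator (V a b) p \<partial>\<mu>) = 0"
    by simp
  then have "AE p in \<mu>. ennreal (w p) * indicator (V a b) p = 0"
    by (subst (asm) nn_integral_0_iff_AE) auto
  then show ?thesis
    by eventually_elim (auto simp: V_def \<Phi>_def indicator_def ennreal_eq_0_iff split: if_splits)
qed

text \<open>Chart points that fail to be interior are mapped to the hyperplane bounding the
  half-space. It is Lebesgue null, and the measure in coordinates has a density with respect to
  Lebesgue measure.\<close>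

lemma AE_chart_interior:
  assumes dens: "positive_smooth_density n \<A> \<mu>" and chart: "(U, \<phi>) \<in> \<A>"
  shows "AE p in \<mu>. p \<in> U \<longrightarrow> p \<in> manifold_interior n \<A>"
proof (cases "openin (top_of_set (coord_space n)) (\<phi> ` U)")
  case True
  then have "U \<subseteq> manifold_interior n \<A>"
    using chart by (auto simp: manifold_interior_def)
  then show ?thesis by auto
next
  case False
  note Up = chart_props[OF chart]
  define b :: 'e where "b = (SOME b. b \<in> Basis)"
  have b: "b \<in> Basis" unfolding b_def using nonempty_Basis by (rule some_in_eq[THEN iffD2])
  have "is_chart n (U, \<phi>)"
    using manifold chart by (auto simp: smooth_manifold_with_boundary_def)
  then have half: "openin (top_of_set (coord_halfspace n)) (\<phi> ` U)"
    using False by (auto simp: is_chart_def)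
  \<comment> \<open>In dimension 0 the half-space contains the origin and so equals the whole
    coordinate space; such a chart was settled by the first case.\<close>
  have "n \<noteq> 0"
  proof
    assume "n = 0"
    then have "coord_halfspace n = (coord_space n :: 'e set)"
      by (auto simp: coord_halfspace_def coord_space_def)
    then show False using half False by simp
  qed
  then have coord: "coord_space n = (UNIV :: 'e set)" "coord_measure n = (lborel :: 'e measure)"
    by (auto simp: coord_space_def coord_measure_def)
  have sets: "sets \<mu> = sets borel"
    using dens by (simp add: positive_smooth_density_def)
  obtain \<rho> :: "'e \<Rightarrow> real" where \<rho>: "smooth_on (\<phi> ` U) \<rho>"
    "distr (restrict_space \<mu> U) borel \<phi> = density lborel (\<lambda>x. ennreal (\<rho> x) * indicator (\<phi> ` U) x)"
    using dens chart coord(2) by (auto simp: positive_smooth_density_def dest!: bspec[OF _ chart])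
  have "(\<lambda>x. indicator (\<phi> ` U) x *\<^sub>R \<rho> x) \<in> borel_measurable borel"
    by (intro borel_measurable_continuous_on_indicator Up(4) smooth_on_imp_continuous_on \<rho>(1))
  then have "(\<lambda>x. ennreal (indicator (\<phi> ` U) x *\<^sub>R \<rho> x)) \<in> borel_measurable lborel"
    by simp
  moreover have "(\<lambda>x. ennreal (indicator (\<phi> ` U) x *\<^sub>R \<rho> x)) = (\<lambda>x. ennreal (\<rho> x) * indicator (\<phi> ` U) x)"
    by (auto simp: indicator_def)
  ultimately have meas: "(\<lambda>x. ennreal (\<rho> x) * indicator (\<phi> ` U) x) \<in> borel_measurable lborel"
    by simp
  have \<phi>: "\<phi> \<in> borel_measurable (restrict_space \<mu> U)"
    using borel_measurable_continuous_on_restrict[OF homeomorphism_cont1[OF Up(2)]]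
    by (subst measurable_cong_sets[OF sets_restrict_space_cong[OF sets] refl])
  have "AE x in lborel. x \<bullet> b \<noteq> 0"
    using AE_lborel_inner_neq[OF b] .
  then have "AE x in distr (restrict_space \<mu> U) borel \<phi>. x \<bullet> b \<noteq> 0"
    unfolding \<rho>(2) AE_density[OF meas] by (auto elim: eventually_mono)
  then have "AE p in restrict_space \<mu> U. \<phi> p \<bullet> b \<noteq> 0"
    by (subst (asm) AE_distr_iff[OF \<phi>]) auto
  then have "AE p in \<mu>. p \<in> U \<longrightarrow> \<phi> p \<bullet> b \<noteq> 0"
    using Up(1) sets sets_eq_imp_space_eq[OF sets] by (subst (asm) AE_restrict_space_iff) auto
  then show ?thesis
  proof eventually_elim
    case (elim p)
    show ?case
    proof
      assume p: "p \<in> U"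
      obtain T where T: "open T" "\<phi> ` U = coord_halfspace n \<inter> T"
        using half by (auto simp: openin_open)
      \<comment> \<open>The strict inequality makes this set open in the full space, as membership
        in \<open>manifold_interior\<close> demands.\<close>
      let ?W = "T \<inter> {x. 0 < x \<bullet> b}"
      have "open ?W"
        using T(1) by (intro open_Int open_Collect_less continuous_intros)
      moreover have "\<phi> p \<in> ?W"
      proof -
        have "\<phi> p \<in> coord_halfspace n \<inter> T" using p T(2) by blast
        then have "\<phi> p \<in> T" "0 \<le> \<phi> p \<bullet> b" by (auto simp: coord_halfspace_def b_def)
        then show ?thesis using p elim by auto
      qed
      moreover have "?W \<subseteq> \<phi> ` U"
        unfolding T(2) by (auto simp: coord_halfspace_def b_def coord)
      ultimately show "p \<in> manifold_interior n \<A>"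
        unfolding manifold_interior_def coord using chart p
        by (auto simp: intro!: bexI[of _ "(U, \<phi>)"] exI[of _ ?W])
    qed
  qed
qed

text \<open>The local result holds on uncountably many boxes, whose exceptional null sets cannot
  simply be united; second countability reduces the cover to a countable one.\<close>

lemma AE_nonpos_of_orthogonal_Cc:
  fixes w :: "'a \<Rightarrow> real"
  assumes dens: "positive_smooth_density n \<A> \<mu>"
    and w: "integrable \<mu> w"
    and orth: "\<And>f. f \<in> Cc_infty_interior n \<A> \<Longrightarrow> (LINT p|\<mu>. f p * w p) = 0"
  shows "AE p in \<mu>. w p \<le> 0"
proof -
  have sets: "sets \<mu> = sets borel"
    using dens by (simp add: positive_smooth_density_def)
  define \<F> where "\<F> = {V. open V \<and> (AE p in \<mu>. p \<in> V \<longrightarrow> w p \<le> 0)}"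
  obtain \<F>' where F': "\<F>' \<subseteq> \<F>" "countable \<F>'" "\<Union>\<F>' = \<Union>\<F>"
    by (rule Lindelof[of \<F>]) (auto simp: \<F>_def)
  have nonpos: "AE p in \<mu>. \<forall>V\<in>\<F>'. p \<in> V \<longrightarrow> w p \<le> 0"
    using F' by (subst AE_ball_countable) (auto simp: \<F>_def)
  have sub: "manifold_interior n \<A> \<subseteq> \<Union>\<F>"
  proof
    fix p assume "p \<in> manifold_interior n \<A>"
    then obtain U \<phi> W where chart: "(U, \<phi>) \<in> \<A>" and p: "p \<in> U" "\<phi> p \<in> W"
      and W: "openin (top_of_set (coord_space n)) W" "W \<subseteq> \<phi> ` U"
      by (auto simp: manifold_interior_def)
    note Up = chart_props[OF chart]
    obtain T where T: "open T" "W = coord_space n \<inter> T"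
      using W(1) by (auto simp: openin_open)
    obtain a b where ab: "cbox a b \<subseteq> T" "\<phi> p \<in> box a b"
      using open_contains_cbox[OF T(1), of "\<phi> p"] p(2) T(2) by (metis IntD2)
    have "open (U \<inter> \<phi> -` box a b)"
      using Up(1) homeomorphism_cont1[OF Up(2)] by (intro continuous_open_preimage) auto
    moreover have "AE q in \<mu>. q \<in> U \<longrightarrow> \<phi> q \<in> box a b \<longrightarrow> w q \<le> 0"
      by (rule AE_nonpos_on_chart_box[OF chart W _ sets w orth]) (use ab T(2) in auto)
    ultimately have "U \<inter> \<phi> -` box a b \<in> \<F>"
      by (auto simp: \<F>_def elim: eventually_mono)
    then show "p \<in> \<Union>\<F>" using p(1) ab(2) by blast
  qed
  have "AE p in \<mu>. p \<in> manifold_interior n \<A>"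
  proof -
    \<comment> \<open>The atlas may itself be uncountable, so discarding the boundary takes a second
      Lindelof argument.\<close>
    define \<G> where "\<G> = {U. open U \<and> (AE p in \<mu>. p \<in> U \<longrightarrow> p \<in> manifold_interior n \<A>)}"
    obtain \<G>' where G': "\<G>' \<subseteq> \<G>" "countable \<G>'" "\<Union>\<G>' = \<Union>\<G>"
      by (rule Lindelof[of \<G>]) (auto simp: \<G>_def)
    have "AE p in \<mu>. \<forall>U\<in>\<G>'. p \<in> U \<longrightarrow> p \<in> manifold_interior n \<A>"
      using G' by (subst AE_ball_countable) (auto simp: \<G>_def)
    moreover have "U \<in> \<G>" if "(U, \<phi>) \<in> \<A>" for U \<phi>
      using AE_chart_interior[OF dens that] chart_props(1)[OF that] by (simp add: \<G>_def)
    then have "(\<Union>(U, \<phi>)\<in>\<A>. U) \<subseteq> \<Union>\<G>" by blast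
    then have "\<Union>\<G>' = UNIV"
      using manifold G'(3) by (auto simp: smooth_manifold_with_boundary_def)
    ultimately show ?thesis by (auto elim!: eventually_mono)
  qed
  with nonpos show ?thesis
  proof eventually_elim
    case (elim p)
    have "p \<in> \<Union>\<F>'" unfolding F'(3) using sub elim(2) by (rule subsetD)
    then obtain V where "V \<in> \<F>'" "p \<in> V" by (rule UnionE)
    then show ?case using elim(1) by blast
  qed
qed

lemma Cc_continuous_bounded:
  assumes f: "f \<in> Cc_infty_interior n \<A>"
  shows "continuous_on UNIV f" "\<exists>C. \<forall>p. \<bar>f p\<bar> \<le> C"
proof -
  have "\<exists>T. p \<in> T \<and> open T \<and> continuous_on T f" for p
  proof -
    have "p \<in> (\<Union>(U, \<phi>)\<in>\<A>. U)"
      using manifold by (simp add: smooth_manifold_with_boundary_def)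
    then obtain U \<phi> where chart: "(U, \<phi>) \<in> \<A>" and p: "p \<in> U" by auto
    note Up = chart_props[OF chart]
    have "smooth_fun \<A> f" using f by (simp add: Cc_infty_interior_def)
    then have "smooth_on (\<phi> ` U) (f \<circ> inv_into U \<phi>)"
      using chart by (auto simp: smooth_fun_def)
    then have "continuous_on U ((f \<circ> inv_into U \<phi>) \<circ> \<phi>)"
      by (intro continuous_on_compose homeomorphism_cont1[OF Up(2)] smooth_on_imp_continuous_on)
    then have "continuous_on U f"
      by (rule continuous_on_eq) (simp add: homeomorphism_apply1[OF Up(2)])
    then show ?thesis using p Up(1) by blast
  qed
  then have "isCont f p" for p
    using continuous_on_eq_continuous_at by metis
  then show cont: "continuous_on UNIV f"
    by (simp add: continuous_at_imp_continuous_on)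
  have "bounded (f ` closure {x. f x \<noteq> 0})"
    using f cont
    by (intro compact_imp_bounded compact_continuous_image) (auto simp: Cc_infty_interior_def intro: continuous_on_subset)
  then obtain C where C: "\<And>x. x \<in> closure {x. f x \<noteq> 0} \<Longrightarrow> \<bar>f x\<bar> \<le> C"
    unfolding bounded_iff by auto
  have "\<bar>f p\<bar> \<le> max C 0" for p
  proof (cases "f p = 0")
    case False
    then have "p \<in> closure {x. f x \<noteq> 0}" using closure_subset[of "{x. f x \<noteq> 0}"] by blast
    from C[OF this] show ?thesis by simp
  qed simp
  then show "\<exists>C. \<forall>p. \<bar>f p\<bar> \<le> C" by blast
qed

lemma Cc_mult_integrable:
  fixes w :: "'a \<Rightarrow> complex"
  assumes dens: "positive_smooth_density n \<A> \<mu>"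
    and w: "integrable \<mu> w" and f: "f \<in> Cc_infty_interior n \<A>"
  shows "integrable \<mu> (\<lambda>p. complex_of_real (f p) * w p)"
proof -
  obtain C where C: "\<And>p. \<bar>f p\<bar> \<le> C" using Cc_continuous_bounded(2)[OF f] by blast
  have [measurable_cong]: "sets \<mu> = sets borel"
    using dens by (simp add: positive_smooth_density_def)
  have [measurable]: "f \<in> borel_measurable borel"
    using borel_measurable_continuous_onI[OF Cc_continuous_bounded(1)[OF f]] .
  show ?thesis
  proof (rule Bochner_Integration.integrable_bound[where f = "\<lambda>p. complex_of_real C * w p"])
    show "AE p in \<mu>. norm (complex_of_real (f p) * w p) \<le> norm (complex_of_real C * w p)"
      using C by (intro AE_I2) (auto simp: norm_mult intro!: mult_right_mono order_trans[OF C])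
  qed (use w in auto)
qed

text \<open>Test functions are real, so the hypothesis splits into real and imaginary parts; the
  one-sided result is applied to each of them and its negative.\<close>

lemma AE_zero_of_orthogonal_Cc:
  fixes w :: "'a \<Rightarrow> complex"
  assumes dens: "positive_smooth_density n \<A> \<mu>"
    and w: "integrable \<mu> w"
    and orth: "\<And>f. f \<in> Cc_infty_interior n \<A> \<Longrightarrow> (LINT p|\<mu>. complex_of_real (f p) * w p) = 0"
  shows "AE p in \<mu>. w p = 0"
proof -
  note int = Cc_mult_integrable[OF dens w]
  have 1: "(LINT p|\<mu>. f p * Re (w p)) = 0" "(LINT p|\<mu>. f p * Im (w p)) = 0"
    if "f \<in> Cc_infty_interior n \<A>" for f
    using integral_Re[OF int[OF that]] integral_Im[OF int[OF that]] orth[OF that] by simp_all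
  have "AE p in \<mu>. Re (w p) \<le> 0" "AE p in \<mu>. - Re (w p) \<le> 0"
    "AE p in \<mu>. Im (w p) \<le> 0" "AE p in \<mu>. - Im (w p) \<le> 0"
    by (rule AE_nonpos_of_orthogonal_Cc[OF dens]; use w 1 in \<open>simp add: integrable_Re integrable_Im\<close>)+
  then show ?thesis by eventually_elim (simp add: complex_eq_iff)
qed

end

section \<open>Orthogonal projection in \<open>L\<^sup>2\<close>\<close>

text \<open>Hilbert space arguments are carried out on functions instead of classes, where sums and
  pointwise limits are literal; classes return only when eigenspaces are treated.\<close>

definition sq_integrable :: "'a measure \<Rightarrow> ('a \<Rightarrow> complex) set" where
  "sq_integrable M = {f \<in> borel_measurable M. integrable M (\<lambda>x. (cmod (f x))\<^sup>2)}"

definition sq_norm :: "'a measure \<Rightarrow> ('a \<Rightarrow> complex) \<Rightarrow> real" where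
  "sq_norm M f = (LINT x|M. (cmod (f x))\<^sup>2)"

definition fun_inner :: "'a measure \<Rightarrow> ('a \<Rightarrow> complex) \<Rightarrow> ('a \<Rightarrow> complex) \<Rightarrow> complex" where
  "fun_inner M f g = (LINT x|M. f x * cnj (g x))"

lemma sq_integrable_measurable [measurable_dest]: "f \<in> sq_integrable M \<Longrightarrow> f \<in> borel_measurable M"
  by (simp add: sq_integrable_def)

lemma sq_integrableD: "f \<in> sq_integrable M \<Longrightarrow> integrable M (\<lambda>x. (cmod (f x))\<^sup>2)"
  by (simp add: sq_integrable_def)

lemma sq_norm_nonneg: "0 \<le> sq_norm M f"
  by (simp add: sq_norm_def)

lemma zero_sq_integrable: "(\<lambda>x. 0) \<in> sq_integrable M"
  by (simp add: sq_integrable_def)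

lemma bounded_mult_sq_integrable:
  assumes [measurable]: "a \<in> borel_measurable M" and a: "AE x in M. cmod (a x) \<le> C"
    and f: "f \<in> sq_integrable M"
  shows "(\<lambda>x. a x * f x) \<in> sq_integrable M"
proof -
  have [measurable]: "f \<in> borel_measurable M" using f by (rule sq_integrable_measurable)
  have "integrable M (\<lambda>x. (cmod (a x * f x))\<^sup>2)"
  proof (rule Bochner_Integration.integrable_bound)
    show "integrable M (\<lambda>x. C\<^sup>2 * (cmod (f x))\<^sup>2)"
      using sq_integrableD[OF f] by simp
    show "AE x in M. norm ((cmod (a x * f x))\<^sup>2) \<le> norm (C\<^sup>2 * (cmod (f x))\<^sup>2)"
      using a
      by eventually_elim
        (auto simp: norm_mult power_mult_distrib intro!: mult_right_mono power_mono)
  qed measurable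
  then show ?thesis by (simp add: sq_integrable_def)
qed

lemma scale_sq_integrable:
  "f \<in> sq_integrable M \<Longrightarrow> (\<lambda>x. c * f x) \<in> sq_integrable M"
  by (rule bounded_mult_sq_integrable[where C = "cmod c"]) auto

lemma add_sq_integrable:
  assumes f: "f \<in> sq_integrable M" and g: "g \<in> sq_integrable M"
  shows "(\<lambda>x. f x + g x) \<in> sq_integrable M"
proof -
  have [measurable]: "f \<in> borel_measurable M" "g \<in> borel_measurable M"
    using f g by (auto intro: sq_integrable_measurable)
  have "integrable M (\<lambda>x. (cmod (f x + g x))\<^sup>2)"
  proof (rule Bochner_Integration.integrable_bound)
    show "integrable M (\<lambda>x. 2 * (cmod (f x))\<^sup>2 + 2 * (cmod (g x))\<^sup>2)"
      using sq_integrableD[OF f] sq_integrableD[OF g] by simp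
    have "(cmod (a + b))\<^sup>2 \<le> 2 * (cmod a)\<^sup>2 + 2 * (cmod b)\<^sup>2" for a b
    proof -
      have "(cmod (a + b))\<^sup>2 \<le> (cmod a + cmod b)\<^sup>2"
        by (intro power_mono norm_triangle_ineq norm_ge_zero)
      also have "\<dots> \<le> 2 * (cmod a)\<^sup>2 + 2 * (cmod b)\<^sup>2"
        using sum_squares_bound[of "cmod a" "cmod b"] by (simp add: power2_sum)
      finally show ?thesis .
    qed
    then show "AE x in M. norm ((cmod (f x + g x))\<^sup>2) \<le> norm (2 * (cmod (f x))\<^sup>2 + 2 * (cmod (g x))\<^sup>2)"
      by (intro AE_I2) simp
  qed measurable
  then show ?thesis by (simp add: sq_integrable_def)
qed

lemma diff_sq_integrable:
  assumes f: "f \<in> sq_integrable M" and g: "g \<in> sq_integrable M"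
  shows "(\<lambda>x. f x - g x) \<in> sq_integrable M"
  using add_sq_integrable[OF f scale_sq_integrable[OF g, of "- 1"]] by simp

lemma borel_measurable_cnj [measurable]: "cnj \<in> borel_measurable borel"
  by (rule borel_measurable_continuous_onI[OF linear_continuous_on[OF bounded_linear_cnj]])

lemma fun_inner_integrable:
  assumes f: "f \<in> sq_integrable M" and g: "g \<in> sq_integrable M"
  shows "integrable M (\<lambda>x. f x * cnj (g x))"
proof -
  have [measurable]: "f \<in> borel_measurable M" "g \<in> borel_measurable M"
    using f g by (auto intro: sq_integrable_measurable)
  show ?thesis
  proof (rule Bochner_Integration.integrable_bound)
    show "integrable M (\<lambda>x. (cmod (f x))\<^sup>2 + (cmod (g x))\<^sup>2)"
      using sq_integrableD[OF f] sq_integrableD[OF g] by simp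
    have "cmod a * cmod b \<le> (cmod a)\<^sup>2 + (cmod b)\<^sup>2" for a b
      using sum_squares_bound[of "cmod a" "cmod b"] mult_nonneg_nonneg[of "cmod a" "cmod b"]
      by (simp add: mult.assoc del: mult_nonneg_nonneg)
    then show "AE x in M. norm (f x * cnj (g x)) \<le> norm ((cmod (f x))\<^sup>2 + (cmod (g x))\<^sup>2)"
      by (intro AE_I2) (simp add: norm_mult)
  qed measurable
qed

lemma fun_inner_add_left:
  assumes "f \<in> sq_integrable M" "g \<in> sq_integrable M" "h \<in> sq_integrable M"
  shows "fun_inner M (\<lambda>x. f x + g x) h = fun_inner M f h + fun_inner M g h"
  using fun_inner_integrable[OF assms(1,3)] fun_inner_integrable[OF assms(2,3)]
  by (simp add: fun_inner_def distrib_right)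

lemma fun_inner_diff_left:
  assumes "f \<in> sq_integrable M" "g \<in> sq_integrable M" "h \<in> sq_integrable M"
  shows "fun_inner M (\<lambda>x. f x - g x) h = fun_inner M f h - fun_inner M g h"
  using fun_inner_integrable[OF assms(1,3)] fun_inner_integrable[OF assms(2,3)]
  by (simp add: fun_inner_def left_diff_distrib)

lemma fun_inner_scale_left: "fun_inner M (\<lambda>x. c * f x) h = c * fun_inner M f h"
  by (simp add: fun_inner_def mult.assoc)

lemma fun_inner_cnj: "fun_inner M g f = cnj (fun_inner M f g)"
  using Bochner_Integration.integral_cnj[of M "\<lambda>x. f x * cnj (g x)"] by (simp add: fun_inner_def mult.commute)

lemma fun_inner_add_right:
  assumes "f \<in> sq_integrable M" "g \<in> sq_integrable M" "h \<in> sq_integrable M"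
  shows "fun_inner M h (\<lambda>x. f x + g x) = fun_inner M h f + fun_inner M h g"
  using fun_inner_add_left[OF assms] by (metis complex_cnj_add fun_inner_cnj)

lemma fun_inner_diff_right:
  assumes "f \<in> sq_integrable M" "g \<in> sq_integrable M" "h \<in> sq_integrable M"
  shows "fun_inner M h (\<lambda>x. f x - g x) = fun_inner M h f - fun_inner M h g"
  using fun_inner_diff_left[OF assms] by (metis complex_cnj_diff fun_inner_cnj)

lemma fun_inner_scale_right: "fun_inner M h (\<lambda>x. c * f x) = cnj c * fun_inner M h f"
  using fun_inner_scale_left[of M c f h] by (metis complex_cnj_mult fun_inner_cnj)

lemma fun_inner_self: "fun_inner M f f = complex_of_real (sq_norm M f)"
  unfolding fun_inner_def sq_norm_def
  by (simp only: complex_norm_square flip: integral_complex_of_real)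

lemma sq_norm_eq_0_iff:
  assumes "f \<in> sq_integrable M"
  shows "sq_norm M f = 0 \<longleftrightarrow> (AE x in M. f x = 0)"
  using integral_nonneg_eq_0_iff_AE[OF sq_integrableD[OF assms]] by (simp add: sq_norm_def)

text \<open>A weighted Young inequality in the role of Cauchy-Schwarz. The free weight
  \<open>t\<close> lets a fixed \<open>f\<close> be balanced against a \<open>g\<close> of small
  norm.\<close>

lemma fun_inner_bound:
  assumes f: "f \<in> sq_integrable M" and g: "g \<in> sq_integrable M" and t: "t > 0"
  shows "cmod (fun_inner M f g) \<le> t * sq_norm M f + sq_norm M g / t"
proof -
  have young: "cmod a * cmod b \<le> t * (cmod a)\<^sup>2 + (cmod b)\<^sup>2 / t" for a b
  proof -
    have "0 \<le> (t * cmod a - cmod b)\<^sup>2 + (t * cmod a * cmod b)" using t by simp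
    then have "t * (cmod a * cmod b) \<le> t * (t * (cmod a)\<^sup>2 + (cmod b)\<^sup>2 / t)"
      using t by (simp add: power2_eq_square algebra_simps)
    then show ?thesis using t by simp
  qed
  have "cmod (fun_inner M f g) \<le> (LINT x|M. cmod (f x * cnj (g x)))"
    unfolding fun_inner_def by (rule integral_norm_bound)
  also have "\<dots> \<le> (LINT x|M. t * (cmod (f x))\<^sup>2 + (cmod (g x))\<^sup>2 / t)"
    using integrable_norm[OF fun_inner_integrable[OF f g]] sq_integrableD[OF f] sq_integrableD[OF g]
    by (intro integral_mono) (auto simp: norm_mult young)
  also have "\<dots> = t * sq_norm M f + sq_norm M g / t"
    using sq_integrableD[OF f] sq_integrableD[OF g] by (simp add: sq_norm_def)
  finally show ?thesis .
qed

text \<open>Serves twice: with \<open>c = 1\<close> and \<open>c = - 1\<close> it gives the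
  parallelogram law, with a small \<open>c\<close> the variation of the distance at a
  minimiser.\<close>

lemma sq_norm_diff_scale:
  assumes f: "f \<in> sq_integrable M" and g: "g \<in> sq_integrable M"
  shows "sq_norm M (\<lambda>x. f x - c * g x) =
    sq_norm M f - 2 * Re (cnj c * fun_inner M f g) + (cmod c)\<^sup>2 * sq_norm M g"
proof -
  note cg = scale_sq_integrable[OF g, of c]
  have "complex_of_real (sq_norm M (\<lambda>x. f x - c * g x)) =
      fun_inner M (\<lambda>x. f x - c * g x) (\<lambda>x. f x - c * g x)"
    by (rule fun_inner_self[symmetric])
  also have "\<dots> = fun_inner M f f - cnj c * fun_inner M f g
      - cnj (cnj c * fun_inner M f g) + c * cnj c * fun_inner M g g"
    using diff_sq_integrable[OF f cg] f g cg fun_inner_cnj[of M g f]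
    by (simp add: fun_inner_diff_left fun_inner_diff_right fun_inner_scale_left fun_inner_scale_right
        algebra_simps)
  also have "\<dots> = complex_of_real (sq_norm M f - 2 * Re (cnj c * fun_inner M f g) + (cmod c)\<^sup>2 * sq_norm M g)"
    by (simp add: fun_inner_self complex_eq_iff cmod_power2) (simp add: power2_eq_square algebra_simps)
  finally show ?thesis by (simp only: of_real_eq_iff)
qed

lemma sq_norm_parallelogram:
  assumes f: "f \<in> sq_integrable M" and g: "g \<in> sq_integrable M"
  shows "sq_norm M (\<lambda>x. f x - g x) = 2 * sq_norm M f + 2 * sq_norm M g - sq_norm M (\<lambda>x. f x + g x)"
  using sq_norm_diff_scale[OF f g, of 1] sq_norm_diff_scale[OF f g, of "- 1"] by simp

text \<open>Lower semicontinuity of the squared norm under almost everywhere convergence. It shows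
  both that the limit of a minimising sequence is square integrable and that it attains the
  infimum.\<close>

lemma sq_integrable_Fatou:
  assumes u: "\<And>k. u k \<in> sq_integrable M" and [measurable]: "v \<in> borel_measurable M"
    and lim: "AE x in M. (\<lambda>k. u k x) \<longlonglongrightarrow> v x"
    and bnd: "\<forall>\<^sub>F k in sequentially. sq_norm M (u k) \<le> B"
  shows "v \<in> sq_integrable M" "sq_norm M v \<le> B"
proof -
  have [measurable]: "u k \<in> borel_measurable M" for k
    using u by (rule sq_integrable_measurable)
  obtain k where "sq_norm M (u k) \<le> B"
    using bnd by (meson eventually_False_sequentially eventually_mono)
  then have B: "0 \<le> B" using sq_norm_nonneg[of M "u k"] by linarith
  have "(\<integral>\<^sup>+x. ennreal ((cmod (v x))\<^sup>2) \<partial>M) = (\<integral>\<^sup>+x. liminf (\<lambda>k. ennreal ((cmod (u k x))\<^sup>2)) \<partial>M)"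
    using lim
  proof (intro nn_integral_cong_AE, eventually_elim)
    case (elim x)
    then have "(\<lambda>k. ennreal ((cmod (u k x))\<^sup>2)) \<longlonglongrightarrow> ennreal ((cmod (v x))\<^sup>2)"
      by (intro tendsto_intros)
    then show ?case
      by (rule lim_imp_Liminf[OF sequentially_bot, symmetric])
  qed
  also have "\<dots> \<le> liminf (\<lambda>k. \<integral>\<^sup>+x. ennreal ((cmod (u k x))\<^sup>2) \<partial>M)"
    by (rule nn_integral_liminf) measurable
  also have "\<dots> \<le> ennreal B"
  proof -
    have "(\<integral>\<^sup>+x. ennreal ((cmod (u k x))\<^sup>2) \<partial>M) = ennreal (sq_norm M (u k))" for k
      unfolding sq_norm_def by (rule nn_integral_eq_integral[OF sq_integrableD[OF u]]) simp
    then have "\<forall>\<^sub>F k in sequentially. (\<integral>\<^sup>+x. ennreal ((cmod (u k x))\<^sup>2) \<partial>M) \<le> ennreal B"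
      using bnd by (auto elim!: eventually_mono intro: ennreal_leI)
    then have "limsup (\<lambda>k. \<integral>\<^sup>+x. ennreal ((cmod (u k x))\<^sup>2) \<partial>M) \<le> ennreal B"
      by (rule Limsup_bounded)
    then show ?thesis
      using Liminf_le_Limsup[OF sequentially_bot] order_trans by blast
  qed
  finally have le: "(\<integral>\<^sup>+x. ennreal ((cmod (v x))\<^sup>2) \<partial>M) \<le> ennreal B" .
  then have "integrable M (\<lambda>x. (cmod (v x))\<^sup>2)"
    by (intro integrableI_bounded) (auto simp: le_less_trans)
  then show v: "v \<in> sq_integrable M"
    by (simp add: sq_integrable_def)
  have "ennreal (sq_norm M v) \<le> ennreal B"
    using le unfolding sq_norm_def by (subst (asm) nn_integral_eq_integral[OF sq_integrableD[OF v]]) auto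
  then show "sq_norm M v \<le> B" using B by simp
qed

text \<open>The rate 16 splits as 4 times 4. One factor pays for the weight \<open>4 ^ k\<close>,
  the other keeps the weighted integrals summable. So the weighted sum of squared increments is
  finite almost everywhere, and there the increments are bounded by a multiple of
  \<open>(1 / 2) ^ k\<close>.\<close>

lemma rapidly_Cauchy_AE_convergent:
  assumes g: "\<And>k. g k \<in> sq_integrable M"
    and cauchy: "\<And>k. sq_norm M (\<lambda>x. g (Suc k) x - g k x) \<le> C * (1 / 16) ^ k"
  shows "AE x in M. convergent (\<lambda>k. g k x)"
proof -
  have [measurable]: "g k \<in> borel_measurable M" for k
    using g by (rule sq_integrable_measurable)
  note dg = diff_sq_integrable[OF g g]
  have C: "0 \<le> C" using cauchy[of 0] sq_norm_nonneg[of M "\<lambda>x. g (Suc 0) x - g 0 x"] by simp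
  have "(\<integral>\<^sup>+x. (\<Sum>k. ennreal (4 ^ k * (cmod (g (Suc k) x - g k x))\<^sup>2)) \<partial>M) =
      (\<Sum>k. \<integral>\<^sup>+x. ennreal (4 ^ k * (cmod (g (Suc k) x - g k x))\<^sup>2) \<partial>M)"
    by (rule nn_integral_suminf) measurable
  also have "\<dots> \<le> (\<Sum>k. ennreal (C * (1 / 4) ^ k))"
  proof (intro suminf_le allI summableI)
    fix k
    have "(\<integral>\<^sup>+x. ennreal (4 ^ k * (cmod (g (Suc k) x - g k x))\<^sup>2) \<partial>M) =
        ennreal (4 ^ k * sq_norm M (\<lambda>x. g (Suc k) x - g k x))"
      unfolding sq_norm_def
      by (subst nn_integral_eq_integral) (use sq_integrableD[OF dg] in auto)
    also have "\<dots> \<le> ennreal (4 ^ k * (C * (1 / 16) ^ k))"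
      by (intro ennreal_leI mult_left_mono cauchy) simp
    also have "4 ^ k * (C * (1 / 16) ^ k) = C * (1 / 4) ^ k"
      by (simp add: power_divide field_simps flip: power_mult_distrib)
    finally show "(\<integral>\<^sup>+x. ennreal (4 ^ k * (cmod (g (Suc k) x - g k x))\<^sup>2) \<partial>M) \<le> ennreal (C * (1 / 4) ^ k)" .
  qed
  also have "\<dots> = ennreal (\<Sum>k. C * (1 / 4) ^ k)"
    using C by (intro suminf_ennreal2 summable_mult summable_geometric) auto
  also have "\<dots> < \<infinity>" by simp
  finally have "AE x in M. (\<Sum>k. ennreal (4 ^ k * (cmod (g (Suc k) x - g k x))\<^sup>2)) \<noteq> \<infinity>"
    by (intro nn_integral_PInf_AE) auto
  then show ?thesis
  proof eventually_elim
    case (elim x)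
    then obtain B where B: "0 \<le> B" "(\<Sum>k. ennreal (4 ^ k * (cmod (g (Suc k) x - g k x))\<^sup>2)) = ennreal B"
      using ennreal_cases[of "\<Sum>k. ennreal (4 ^ k * (cmod (g (Suc k) x - g k x))\<^sup>2)"] by auto
    have le: "cmod (g (Suc k) x - g k x) \<le> sqrt B * (1 / 2) ^ k" for k
    proof -
      have "ennreal (4 ^ k * (cmod (g (Suc k) x - g k x))\<^sup>2) \<le> ennreal B"
        using sum_le_suminf[of "\<lambda>k. ennreal (4 ^ k * (cmod (g (Suc k) x - g k x))\<^sup>2)" "{k}"]
        unfolding B(2) by simp
      then have "4 ^ k * (cmod (g (Suc k) x - g k x))\<^sup>2 \<le> B" using B(1) by simp
      moreover have "(4::real) ^ k = (2 ^ k)\<^sup>2" by (simp add: power2_eq_square flip: power_mult_distrib)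
      ultimately have "(2 ^ k * cmod (g (Suc k) x - g k x))\<^sup>2 \<le> B" by (simp add: power_mult_distrib)
      then have "2 ^ k * cmod (g (Suc k) x - g k x) \<le> sqrt B" by (rule real_le_rsqrt)
      then show ?thesis by (simp add: power_divide field_simps)
    qed
    have "summable (\<lambda>k. g (Suc k) x - g k x)"
    proof (rule summable_comparison_test')
      show "summable (\<lambda>k. sqrt B * (1 / 2) ^ k)"
        by (intro summable_mult summable_geometric) simp
    qed (rule le)
    then have "convergent (\<lambda>n. (\<Sum>k<n. g (Suc k) x - g k x))"
      by (simp add: summable_iff_convergent)
    then have "convergent (\<lambda>n. g n x - g 0 x)"
      by (simp add: sum_lessThan_telescope[of "\<lambda>k. g k x"])
    then show ?case
      using convergent_add[OF _ convergent_const[of "g 0 x"], of "\<lambda>n. g n x - g 0 x"] by simp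
  qed
qed

text \<open>The classical minimisation of the distance to \<open>K\<close>. As an annihilator,
  \<open>K\<close> is closed under linear combinations and under limits in the mean.\<close>

lemma orthogonal_projection_exists:
  assumes S: "S \<subseteq> sq_integrable M" and f: "f \<in> sq_integrable M"
  defines "K \<equiv> {g \<in> sq_integrable M. \<forall>s\<in>S. fun_inner M s g = 0}"
  shows "\<exists>p\<in>K. \<forall>h\<in>K. fun_inner M (\<lambda>x. f x - p x) h = 0"
proof -
  have K_sq: "g \<in> sq_integrable M" if "g \<in> K" for g using that by (simp add: K_def)
  have K_add: "(\<lambda>x. g x + c * h x) \<in> K" if "g \<in> K" "h \<in> K" for g h c
  proof -
    have "g \<in> sq_integrable M" and ch: "(\<lambda>x. c * h x) \<in> sq_integrable M"
      using that scale_sq_integrable by (auto simp: K_def)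
    moreover from this have "fun_inner M s (\<lambda>x. g x + c * h x) = 0" if "s \<in> S" for s
      using that S \<open>g \<in> K\<close> \<open>h \<in> K\<close>
      by (auto simp: K_def fun_inner_add_right fun_inner_scale_right)
    ultimately show ?thesis by (simp add: K_def add_sq_integrable)
  qed
  have zero: "(\<lambda>x. 0) \<in> K" by (simp add: K_def zero_sq_integrable fun_inner_def)
  define N where "N g = sq_norm M (\<lambda>x. f x - g x)" for g
  define d where "d = Inf (N ` K)"
  have bdd: "bdd_below (N ` K)" by (rule bdd_belowI2[of _ 0]) (simp add: N_def sq_norm_nonneg)
  have d_le: "d \<le> N g" if "g \<in> K" for g
    unfolding d_def by (rule cINF_lower[OF bdd that])
  have "\<exists>g\<in>K. N g < d + (1 / 16) ^ k" for k :: nat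
    using cINF_less_iff[OF _ bdd, of "d + (1 / 16) ^ k"] zero by (auto simp: d_def)
  then obtain g where g: "\<And>k. g k \<in> K" "\<And>k. N (g k) < d + (1 / 16) ^ k" by metis
  note g_sq = K_sq[OF g(1)]
  have cauchy: "sq_norm M (\<lambda>x. g m x - g k x) \<le> 4 * (1 / 16) ^ k" if "k \<le> m" for k m
  proof -
    \<comment> \<open>The midpoint stays in \<open>K\<close>, so its distance is at least the
      infimum; the parallelogram law then makes the minimising sequence Cauchy.\<close>
    have mid: "(\<lambda>x. (1 / 2) * g k x + (1 / 2) * g m x) \<in> K"
      using K_add[OF K_add[OF zero g(1)] g(1), of "1 / 2" k "1 / 2" m] by simp
    have "4 * N (\<lambda>x. (1 / 2) * g k x + (1 / 2) * g m x) = sq_norm M (\<lambda>x. (f x - g k x) + (f x - g m x))"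
    proof -
      have "4 * (cmod (f x - ((1 / 2) * g k x + (1 / 2) * g m x)))\<^sup>2 =
          (cmod ((f x - g k x) + (f x - g m x)))\<^sup>2" for x
      proof -
        have "(f x - g k x) + (f x - g m x) = 2 * (f x - ((1 / 2) * g k x + (1 / 2) * g m x))"
          by (simp add: algebra_simps)
        then show ?thesis by (simp only: norm_mult power_mult_distrib) simp
      qed
      then show ?thesis
        unfolding N_def sq_norm_def by (simp flip: integral_mult_right_zero)
    qed
    then have "sq_norm M (\<lambda>x. (f x - g k x) - (f x - g m x)) \<le> 2 * N (g k) + 2 * N (g m) - 4 * d"
      using sq_norm_parallelogram[OF diff_sq_integrable[OF f g_sq] diff_sq_integrable[OF f g_sq], of k m]
        d_le[OF mid] by (simp add: N_def)
    also have "\<dots> \<le> 2 * (1 / 16) ^ k + 2 * (1 / 16) ^ m"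
      using g(2)[of k] g(2)[of m] by simp
    also have "\<dots> \<le> 4 * (1 / 16) ^ k"
      using power_decreasing[OF that, of "1 / 16 :: real"] by simp
    finally show ?thesis by simp
  qed
  have [measurable]: "g k \<in> borel_measurable M" for k
    by (rule sq_integrable_measurable[OF g_sq])
  have f_meas [measurable]: "f \<in> borel_measurable M"
    by (rule sq_integrable_measurable[OF f])
  \<comment> \<open>Where the sequence diverges, \<open>lim\<close> has an unspecified value; this
    happens on a null set only, and \<open>p\<close> is still measurable.\<close>
  define p where "p x = lim (\<lambda>k. g k x)" for x
  have p_meas [measurable]: "p \<in> borel_measurable M"
    unfolding p_def[abs_def] by (rule borel_measurable_lim_metric) measurable
  have "AE x in M. convergent (\<lambda>k. g k x)"
    by (rule rapidly_Cauchy_AE_convergent[where C = 4, OF g_sq cauchy]) simp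
  then have lim: "AE x in M. (\<lambda>k. g k x) \<longlonglongrightarrow> p x"
    by eventually_elim (simp add: p_def convergent_LIMSEQ_iff)
  have pg: "(\<lambda>x. p x - g k x) \<in> sq_integrable M" "sq_norm M (\<lambda>x. p x - g k x) \<le> 4 * (1 / 16) ^ k" for k
  proof -
    have lim': "AE x in M. (\<lambda>m. g m x - g k x) \<longlonglongrightarrow> p x - g k x"
      using lim by eventually_elim (intro tendsto_intros)
    have bnd: "\<forall>\<^sub>F m in sequentially. sq_norm M (\<lambda>x. g m x - g k x) \<le> 4 * (1 / 16) ^ k"
      by (rule eventually_mono[OF eventually_ge_at_top[of k]]) (rule cauchy)
    have meas: "(\<lambda>x. p x - g k x) \<in> borel_measurable M" by measurable
    note Fatou = sq_integrable_Fatou[OF diff_sq_integrable[OF g_sq g_sq] meas lim' bnd]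
    show "(\<lambda>x. p x - g k x) \<in> sq_integrable M" by (rule Fatou(1))
    show "sq_norm M (\<lambda>x. p x - g k x) \<le> 4 * (1 / 16) ^ k" by (rule Fatou(2))
  qed
  have p_sq: "p \<in> sq_integrable M"
    using add_sq_integrable[OF pg(1)[of 0] g_sq[of 0]] by simp
  have "fun_inner M s p = 0" if s: "s \<in> S" for s
  proof -
    have s_sq: "s \<in> sq_integrable M" using S s by blast
    \<comment> \<open>The weight \<open>(1 / 4) ^ k\<close> is the square root of the error
      \<open>(1 / 16) ^ k\<close>, so both terms of the bound decay like
      \<open>(1 / 4) ^ k\<close>.\<close>
    have "cmod (fun_inner M s p) \<le> (1 / 4) ^ k * (sq_norm M s + 4)" for k
    proof -
      have "fun_inner M s (g k) = 0" using g(1)[of k] s by (simp add: K_def)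
      then have "fun_inner M s p = fun_inner M s (\<lambda>x. p x - g k x)"
        by (simp add: fun_inner_diff_right[OF p_sq g_sq s_sq])
      then have "cmod (fun_inner M s p) \<le> (1 / 4) ^ k * sq_norm M s + sq_norm M (\<lambda>x. p x - g k x) / (1 / 4) ^ k"
        using fun_inner_bound[OF s_sq pg(1), of "(1 / 4) ^ k" k] by simp
      also have "\<dots> \<le> (1 / 4) ^ k * sq_norm M s + 4 * (1 / 16) ^ k / (1 / 4) ^ k"
        by (intro add_left_mono divide_right_mono pg(2)) simp
      also have "4 * (1 / 16) ^ k / (1 / 4) ^ k = (1 / 4) ^ k * (4::real)"
        by (simp add: power_divide field_simps flip: power_mult_distrib)
      finally show ?thesis by (simp add: algebra_simps)
    qed
    moreover have "(\<lambda>k. (1 / 4) ^ k * (sq_norm M s + 4)) \<longlonglongrightarrow> 0 * (sq_norm M s + 4)"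
      by (intro tendsto_mult tendsto_const LIMSEQ_realpow_zero) auto
    ultimately have "cmod (fun_inner M s p) \<le> 0 * (sq_norm M s + 4)"
      by (intro LIMSEQ_le_const) auto
    then show ?thesis by simp
  qed
  then have pK: "p \<in> K" using p_sq by (simp add: K_def)
  have "N p \<le> d + e" if e: "e > 0" for e
    unfolding N_def
  proof (rule sq_integrable_Fatou(2))
    show "(\<lambda>x. f x - g k x) \<in> sq_integrable M" for k
      by (rule diff_sq_integrable[OF f g_sq])
    show "AE x in M. (\<lambda>k. f x - g k x) \<longlonglongrightarrow> f x - p x"
      using lim by eventually_elim (intro tendsto_intros)
    have "\<forall>\<^sub>F k in sequentially. (1 / 16 :: real) ^ k < e"
      using LIMSEQ_realpow_zero[of "1 / 16 :: real"] e by (intro order_tendstoD) auto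
    then show "\<forall>\<^sub>F k in sequentially. sq_norm M (\<lambda>x. f x - g k x) \<le> d + e"
    proof eventually_elim
      case (elim k)
      then show ?case using g(2)[of k] by (simp add: N_def)
    qed
  qed measurable
  then have Np: "N p \<le> d" by (rule field_le_epsilon)
  have "fun_inner M (\<lambda>x. f x - p x) h = 0" if h: "h \<in> K" for h
  proof -
    let ?a = "\<lambda>x. f x - p x"
    let ?i = "fun_inner M ?a h" and ?H = "sq_norm M h"
    \<comment> \<open>Moving \<open>p\<close> by \<open>c * h\<close> changes the squared distance
      by \<open>t * (cmod ?i)\<^sup>2 * (t * ?H - 2)\<close>. The \<open>+ 1\<close> covers
      \<open>?H = 0\<close> and gives \<open>t * ?H < 1\<close>, so a nonzero \<open>?i\<close>
      would lower the minimum.\<close>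
    define t where "t = 1 / (?H + 1)"
    have H: "0 \<le> ?H" by (rule sq_norm_nonneg)
    have t: "0 < t" "t * ?H < 1" using H by (auto simp: t_def)
    define c where "c = complex_of_real t * ?i"
    have "d \<le> N (\<lambda>x. p x + c * h x)" by (rule d_le[OF K_add[OF pK h]])
    also have "\<dots> = sq_norm M (\<lambda>x. ?a x - c * h x)" by (simp add: N_def diff_diff_eq)
    also have "\<dots> = N p - 2 * Re (cnj c * ?i) + (cmod c)\<^sup>2 * ?H"
      using sq_norm_diff_scale[OF diff_sq_integrable[OF f p_sq] K_sq[OF h]] by (simp add: N_def)
    also have "Re (cnj c * ?i) = t * (cmod ?i)\<^sup>2"
      by (simp add: c_def cmod_power2) (simp add: power2_eq_square algebra_simps)
    also have "(cmod c)\<^sup>2 = t\<^sup>2 * (cmod ?i)\<^sup>2"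
      by (simp add: c_def norm_mult power_mult_distrib)
    finally have "0 \<le> t * (cmod ?i)\<^sup>2 * (t * ?H - 2)"
      using Np by (simp add: power2_eq_square algebra_simps)
    then have "(cmod ?i)\<^sup>2 \<le> 0"
      using t by (auto simp: zero_le_mult_iff mult_le_0_iff)
    then show ?thesis by simp
  qed
  with pK show ?thesis by blast
qed

section \<open>Eigenspaces of the perturbed operator\<close>

lemma ae_class_cong: "AE x in M. f x = g x \<Longrightarrow> ae_class M f = ae_class M g"
  unfolding ae_class_def by (auto elim!: eventually_elim2)

lemma self_in_ae_class: "f \<in> borel_measurable M \<Longrightarrow> f \<in> ae_class M f"
  by (simp add: ae_class_def)

lemma ae_class_eq_iff:
  assumes "f \<in> borel_measurable M"
  shows "ae_class M f = ae_class M g \<longleftrightarrow> (AE x in M. f x = g x)"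
proof
  assume "ae_class M f = ae_class M g"
  then have "f \<in> ae_class M g" using self_in_ae_class[OF assms] by simp
  then show "AE x in M. f x = g x" by (simp add: ae_class_def)
qed (rule ae_class_cong)

lemma rep_ae_class:
  assumes "f \<in> borel_measurable M"
  shows "rep (ae_class M f) \<in> borel_measurable M" "AE x in M. rep (ae_class M f) x = f x"
proof -
  have "rep (ae_class M f) \<in> ae_class M f"
    unfolding rep_def using someI[of "\<lambda>g. g \<in> ae_class M f", OF self_in_ae_class[OF assms]] .
  then show "rep (ae_class M f) \<in> borel_measurable M" "AE x in M. rep (ae_class M f) x = f x"
    by (auto simp: ae_class_def)
qed

lemma sq_integrable_cong_AE:
  assumes f: "f \<in> sq_integrable M" and g: "g \<in> borel_measurable M" and eq: "AE x in M. g x = f x"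
  shows "g \<in> sq_integrable M"
proof -
  have "integrable M (\<lambda>x. (cmod (g x))\<^sup>2)"
    using f g eq
    by (intro integrable_cong_AE_imp[OF sq_integrableD[OF f]]) (auto elim!: eventually_mono)
  then show ?thesis using g by (simp add: sq_integrable_def)
qed

lemma fun_inner_cong_AE:
  assumes "f \<in> sq_integrable M" "f' \<in> sq_integrable M" "g \<in> sq_integrable M" "g' \<in> sq_integrable M"
    and "AE x in M. f x = f' x" "AE x in M. g x = g' x"
  shows "fun_inner M f g = fun_inner M f' g'"
  unfolding fun_inner_def
proof (rule integral_cong_AE)
  show "AE x in M. f x * cnj (g x) = f' x * cnj (g' x)"
    using assms(5,6) by eventually_elim simp
qed (use assms(1-4) fun_inner_integrable in \<open>blast intro: borel_measurable_integrable\<close>)+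

lemma L2_iff: "u \<in> L2 M \<longleftrightarrow> (\<exists>f\<in>sq_integrable M. u = ae_class M f)"
  by (auto simp: L2_def sq_integrable_def)

lemma ae_class_in_L2: "f \<in> sq_integrable M \<Longrightarrow> ae_class M f \<in> L2 M"
  by (auto simp: L2_iff)

lemma rep_ae_class_sq_integrable:
  assumes "f \<in> sq_integrable M"
  shows "rep (ae_class M f) \<in> sq_integrable M"
  using rep_ae_class[OF sq_integrable_measurable[OF assms]] by (rule sq_integrable_cong_AE[OF assms])

lemma rep_L2:
  assumes "u \<in> L2 M"
  shows "rep u \<in> sq_integrable M" "ae_class M (rep u) = u"
proof -
  obtain f where f: "f \<in> sq_integrable M" "u = ae_class M f" using assms by (auto simp: L2_iff)
  show "rep u \<in> sq_integrable M"
    using rep_ae_class_sq_integrable[OF f(1)] f(2) by simp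
  show "ae_class M (rep u) = u"
    using rep_ae_class(2)[OF sq_integrable_measurable[OF f(1)]] f(2) by (simp add: ae_class_cong)
qed

lemma rep_Linf:
  assumes "q \<in> Linf M"
  shows "rep q \<in> borel_measurable M" "\<exists>C. AE x in M. \<bar>rep q x\<bar> \<le> C"
proof -
  obtain f C where f: "f \<in> borel_measurable M" "AE x in M. \<bar>f x\<bar> \<le> C" "q = ae_class M f"
    using assms by (auto simp: Linf_def)
  show "rep q \<in> borel_measurable M" using rep_ae_class(1)[OF f(1)] f(3) by simp
  have "AE x in M. \<bar>rep q x\<bar> \<le> C"
    using rep_ae_class(2)[OF f(1)] f(2) unfolding f(3)[symmetric] by eventually_elim simp
  then show "\<exists>C. AE x in M. \<bar>rep q x\<bar> \<le> C" by blast
qed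

lemma Linf_mult_sq_integrable:
  assumes q: "q \<in> Linf M" and f: "f \<in> sq_integrable M"
  shows "(\<lambda>x. complex_of_real (rep q x) * f x) \<in> sq_integrable M"
proof -
  obtain C where "AE x in M. \<bar>rep q x\<bar> \<le> C" using rep_Linf(2)[OF q] by blast
  then show ?thesis
    using rep_Linf(1)[OF q] by (intro bounded_mult_sq_integrable[OF _ _ f, of _ C]) auto
qed

lemma L2_inner_ae_class:
  assumes "f \<in> sq_integrable M" "h \<in> L2 M"
  shows "L2_inner M (ae_class M f) h = fun_inner M f (rep h)"
  unfolding L2_inner_def fun_inner_def[symmetric]
  using assms rep_ae_class(2)[OF sq_integrable_measurable[OF assms(1)]]
  by (intro fun_inner_cong_AE rep_ae_class_sq_integrable rep_L2) auto

lemma L2_inner_ae_class_right: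
  assumes "u \<in> L2 M" "f \<in> sq_integrable M"
  shows "L2_inner M u (ae_class M f) = fun_inner M (rep u) f"
  unfolding L2_inner_def fun_inner_def[symmetric]
  using assms rep_ae_class(2)[OF sq_integrable_measurable[OF assms(2)]]
  by (intro fun_inner_cong_AE rep_ae_class_sq_integrable rep_L2) auto

definition orth_complement :: "'a measure \<Rightarrow> ('a \<Rightarrow> complex) set \<Rightarrow> ('a \<Rightarrow> complex) set" where
  "orth_complement M S = {g \<in> sq_integrable M. \<forall>s\<in>S. fun_inner M s g = 0}"

lemma orth_complement_add_scale:
  assumes S: "S \<subseteq> sq_integrable M" and gh: "g \<in> orth_complement M S" "h \<in> orth_complement M S"
  shows "(\<lambda>x. g x + c * h x) \<in> orth_complement M S"
proof -
  have g: "g \<in> sq_integrable M" and ch: "(\<lambda>x. c * h x) \<in> sq_integrable M"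
    using gh scale_sq_integrable by (auto simp: orth_complement_def)
  have "fun_inner M s (\<lambda>x. g x + c * h x) = 0" if "s \<in> S" for s
    using fun_inner_add_right[OF g ch, of s] gh S that
    by (auto simp: orth_complement_def fun_inner_scale_right)
  then show ?thesis by (simp add: orth_complement_def add_sq_integrable[OF g ch])
qed

text \<open>\<open>(L + M\<^sub>q - z) v = 0\<close> says that \<open>(v, (z - q) v)\<close> lies in the graph of \<open>L = L\<^sup>*\<close>, that is,
  that \<open>v\<close> is orthogonal to the range of \<open>L + M\<^sub>q - cnj z\<close>; in particular eigenspaces are closed.\<close>

definition shifted_range ::
  "'a measure \<Rightarrow> ('a, complex) fclass set \<Rightarrow> 'a L2_map \<Rightarrow> ('a, real) fclass \<Rightarrow> complex \<Rightarrow> ('a \<Rightarrow> complex) set" where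
  "shifted_range M D L q z =
     (\<lambda>s x. rep (L s) x - (cnj z * rep s x - complex_of_real (rep q x) * rep s x)) ` D"

context
  fixes M :: "'a measure" and D :: "('a, complex) fclass set" and L :: "'a L2_map"
    and q :: "('a, real) fclass" and z :: complex
  assumes sa: "self_adjoint_operator M D L" and q: "q \<in> Linf M"
begin

lemma D_L2: "s \<in> D \<Longrightarrow> s \<in> L2 M" and L_L2: "s \<in> D \<Longrightarrow> L s \<in> L2 M"
  using sa by (auto simp: self_adjoint_operator_def densely_defined_operator_def L2_subspace_def)

lemma sq_shift:
  "v \<in> sq_integrable M \<Longrightarrow> (\<lambda>x. c * v x - complex_of_real (rep q x) * v x) \<in> sq_integrable M"
  by (intro diff_sq_integrable scale_sq_integrable Linf_mult_sq_integrable q)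

lemma shifted_range_subset: "shifted_range M D L q z \<subseteq> sq_integrable M"
  unfolding shifted_range_def
  by (intro image_subsetI diff_sq_integrable[OF _ sq_shift] rep_L2 D_L2 L_L2)

lemma eigenspace_subset_L2: "eigenspace M D (perturbed M L q) z \<subseteq> L2 M"
  using D_L2 by (auto simp: eigenspace_def)

lemma eigenspace_iff:
  assumes v: "v \<in> L2 M"
  shows "v \<in> eigenspace M D (perturbed M L q) z \<longleftrightarrow> rep v \<in> orth_complement M (shifted_range M D L q z)"
proof -
  note rv = rep_L2(1)[OF v]
  \<comment> \<open>The value \<open>L v\<close> must have for \<open>v\<close> to be an
    eigenvector.\<close>
  define w0 where "w0 x = z * rep v x - complex_of_real (rep q x) * rep v x" for x
  have w0: "w0 \<in> sq_integrable M" unfolding w0_def[abs_def] by (rule sq_shift[OF rv])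
  define w where "w = ae_class M w0"
  have w: "w \<in> L2 M" unfolding w_def by (rule ae_class_in_L2[OF w0])
  have inner: "fun_inner M (\<lambda>x. rep (L s) x - (cnj z * rep s x - complex_of_real (rep q x) * rep s x)) (rep v) =
      L2_inner M (L s) v - L2_inner M s w" if s: "s \<in> D" for s
  proof -
    note rs = rep_L2(1)[OF D_L2[OF s]] and rL = rep_L2(1)[OF L_L2[OF s]]
    \<comment> \<open>Moving the multiplier to the other side conjugates it; \<open>q\<close> is
      real, so cnj z - q becomes z - q.\<close>
    have "fun_inner M (\<lambda>x. cnj z * rep s x - complex_of_real (rep q x) * rep s x) (rep v) = fun_inner M (rep s) w0"
      unfolding fun_inner_def w0_def by (simp add: algebra_simps)
    also have "\<dots> = L2_inner M s w"
      unfolding w_def by (rule L2_inner_ae_class_right[OF D_L2[OF s] w0, symmetric])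
    finally show ?thesis
      using fun_inner_diff_left[OF rL sq_shift[OF rs] rv] by (simp add: L2_inner_def fun_inner_def)
  qed
  have "rep v \<in> orth_complement M (shifted_range M D L q z) \<longleftrightarrow> (v, w) \<in> adjoint_graph M D L"
    using rv v w by (auto simp: orth_complement_def shifted_range_def adjoint_graph_def inner)
  \<comment> \<open>Self-adjointness enters here: a pair in the adjoint graph has its first entry in
    \<open>D\<close>, so a purely weak condition already yields membership in the domain.\<close>
  also have "\<dots> \<longleftrightarrow> v \<in> D \<and> L v = w"
    using sa by (auto simp: self_adjoint_operator_def)
  also have "\<dots> \<longleftrightarrow> v \<in> eigenspace M D (perturbed M L q) z"
  proof -
    have "L v = w \<longleftrightarrow> ae_diff M (perturbed M L q v) (ae_scale M z v) = ae_zero M" if "v \<in> D"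
    proof -
      note rL = rep_L2[OF L_L2[OF that]]
      note qv = Linf_mult_sq_integrable[OF q rv] and zv = scale_sq_integrable[OF rv, of z]
      have mq: "AE x in M. rep (mult_op M q v) x = complex_of_real (rep q x) * rep v x"
        "rep (mult_op M q v) \<in> sq_integrable M"
        unfolding mult_op_def
        by (intro rep_ae_class(2)[OF sq_integrable_measurable] rep_ae_class_sq_integrable qv)+
      have p: "AE x in M. rep (perturbed M L q v) x = rep (L v) x + rep (mult_op M q v) x"
        "rep (perturbed M L q v) \<in> sq_integrable M"
        unfolding perturbed_def ae_add_def
        by (intro rep_ae_class(2)[OF sq_integrable_measurable] rep_ae_class_sq_integrable
            add_sq_integrable rL(1) mq(2))+
      have sc: "AE x in M. rep (ae_scale M z v) x = z * rep v x"
        "rep (ae_scale M z v) \<in> sq_integrable M"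
        unfolding ae_scale_def
        by (intro rep_ae_class(2)[OF sq_integrable_measurable] rep_ae_class_sq_integrable zv)+
      have "ae_diff M (perturbed M L q v) (ae_scale M z v) = ae_zero M \<longleftrightarrow>
          (AE x in M. rep (perturbed M L q v) x - rep (ae_scale M z v) x = 0)"
        unfolding ae_diff_def ae_zero_def
        by (intro ae_class_eq_iff sq_integrable_measurable diff_sq_integrable p sc)
      also have "\<dots> \<longleftrightarrow> (AE x in M. rep (L v) x = w0 x)"
      proof (rule eventually_cong[OF eventually_conj[OF mq(1) eventually_conj[OF p(1) sc(1)]]])
        fix x
        assume "rep (mult_op M q v) x = complex_of_real (rep q x) * rep v x \<and>
          rep (perturbed M L q v) x = rep (L v) x + rep (mult_op M q v) x \<and>
          rep (ae_scale M z v) x = z * rep v x"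
        then show "rep (perturbed M L q v) x - rep (ae_scale M z v) x = 0 \<longleftrightarrow> rep (L v) x = w0 x"
          by (auto simp: w0_def algebra_simps)
      qed
      also have "\<dots> \<longleftrightarrow> ae_class M (rep (L v)) = w"
        unfolding w_def by (rule ae_class_eq_iff[OF sq_integrable_measurable[OF rL(1)], symmetric])
      finally show ?thesis using rL(2) by simp
    qed
    then show ?thesis by (auto simp: eigenspace_def)
  qed
  finally show ?thesis by blast
qed

text \<open>The way back from functions to classes: orthogonality to the range does not depend on
  the representative.\<close>

lemma ae_class_in_eigenspace:
  assumes p: "p \<in> orth_complement M (shifted_range M D L q z)"
  shows "ae_class M p \<in> eigenspace M D (perturbed M L q) z"
proof -
  have p_sq: "p \<in> sq_integrable M" using p by (simp add: orth_complement_def)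
  have "fun_inner M s (rep (ae_class M p)) = fun_inner M s p" if "s \<in> shifted_range M D L q z" for s
    using that shifted_range_subset p_sq rep_ae_class(2)[OF sq_integrable_measurable[OF p_sq]]
    by (intro fun_inner_cong_AE rep_ae_class_sq_integrable) auto
  then have "rep (ae_class M p) \<in> orth_complement M (shifted_range M D L q z)"
    using p rep_ae_class_sq_integrable[OF p_sq] by (simp add: orth_complement_def)
  then show ?thesis using eigenspace_iff[OF ae_class_in_L2[OF p_sq]] by simp
qed

text \<open>The description in \<open>L2_proj\<close> also requires uniqueness. Any candidate
  differs from the constructed one by an element of the complement that is orthogonal to itself,
  hence null.\<close>

lemma L2_proj_eigenspace:
  assumes F: "F \<in> L2 M"
  defines "E \<equiv> eigenspace M D (perturbed M L q) z"
  shows "L2_proj M E F \<in> E \<and> (\<forall>h\<in>E. L2_inner M (ae_diff M F (L2_proj M E F)) h = 0)"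
  unfolding L2_proj_def
proof (rule theI')
  let ?K = "orth_complement M (shifted_range M D L q z)"
  have E_L2: "h \<in> L2 M" if "h \<in> E" for h using that eigenspace_subset_L2 by (auto simp: E_def)
  have E_K: "rep h \<in> ?K" if "h \<in> E" for h
    using eigenspace_iff[OF E_L2[OF that]] that by (simp add: E_def)
  have K_E: "ae_class M p \<in> E" if "p \<in> ?K" for p
    unfolding E_def using that by (rule ae_class_in_eigenspace)
  note rF = rep_L2(1)[OF F]
  have inner: "L2_inner M (ae_diff M F g) h = fun_inner M (rep F) (rep h) - fun_inner M (rep g) (rep h)"
    if g: "g \<in> L2 M" and h: "h \<in> L2 M" for g h
    unfolding ae_diff_def L2_inner_ae_class[OF diff_sq_integrable[OF rF rep_L2(1)[OF g]] h]
    by (rule fun_inner_diff_left[OF rF rep_L2(1)[OF g] rep_L2(1)[OF h]])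
  obtain p where p: "p \<in> ?K" "\<And>h. h \<in> ?K \<Longrightarrow> fun_inner M (\<lambda>x. rep F x - p x) h = 0"
    using orthogonal_projection_exists[OF shifted_range_subset rF] by (auto simp: orth_complement_def)
  have p_sq: "p \<in> sq_integrable M" using p(1) by (simp add: orth_complement_def)
  show "\<exists>!g. g \<in> E \<and> (\<forall>h\<in>E. L2_inner M (ae_diff M F g) h = 0)"
  proof (rule ex1I)
    have "L2_inner M (ae_diff M F (ae_class M p)) h = 0" if h: "h \<in> E" for h
    proof -
      note rh = rep_L2(1)[OF E_L2[OF h]]
      have "fun_inner M (rep (ae_class M p)) (rep h) = fun_inner M p (rep h)"
        using L2_inner_ae_class[OF p_sq E_L2[OF h]] by (simp add: L2_inner_def fun_inner_def)
      then show ?thesis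
        using inner[OF ae_class_in_L2[OF p_sq] E_L2[OF h]] p(2)[OF E_K[OF h]]
          fun_inner_diff_left[OF rF p_sq rh] by simp
    qed
    then show "ae_class M p \<in> E \<and> (\<forall>h\<in>E. L2_inner M (ae_diff M F (ae_class M p)) h = 0)"
      using K_E[OF p(1)] by blast
  next
    fix g assume "g \<in> E \<and> (\<forall>h\<in>E. L2_inner M (ae_diff M F g) h = 0)"
    then have g: "g \<in> E" "\<And>h. h \<in> E \<Longrightarrow> L2_inner M (ae_diff M F g) h = 0" by auto
    note rg = rep_L2(1)[OF E_L2[OF g(1)]]
    let ?e = "\<lambda>x. rep g x - p x"
    have e_sq: "?e \<in> sq_integrable M" by (rule diff_sq_integrable[OF rg p_sq])
    have e: "?e \<in> ?K"
      using orth_complement_add_scale[OF shifted_range_subset E_K[OF g(1)] p(1), of "- 1"] by simp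
    have "fun_inner M (rep F) ?e - fun_inner M (rep g) ?e = 0"
    proof -
      have "L2_inner M (ae_diff M F g) (ae_class M ?e) = 0" by (rule g(2)[OF K_E[OF e]])
      then have "fun_inner M (\<lambda>x. rep F x - rep g x) ?e = 0"
        unfolding ae_diff_def
        using L2_inner_ae_class_right[OF ae_class_in_L2[OF diff_sq_integrable[OF rF rg]] e_sq]
          fun_inner_cong_AE[OF rep_ae_class_sq_integrable[OF diff_sq_integrable[OF rF rg]]
            diff_sq_integrable[OF rF rg] e_sq e_sq
            rep_ae_class(2)[OF sq_integrable_measurable[OF diff_sq_integrable[OF rF rg]]]]
        by simp
      then show ?thesis by (simp add: fun_inner_diff_left[OF rF rg e_sq])
    qed
    moreover have "fun_inner M (rep F) ?e - fun_inner M p ?e = 0"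
      using p(2)[OF e] by (simp add: fun_inner_diff_left[OF rF p_sq e_sq])
    ultimately have "fun_inner M ?e ?e = 0"
      using fun_inner_diff_left[OF rg p_sq e_sq] by simp
    then have "AE x in M. ?e x = 0"
      using sq_norm_eq_0_iff[OF e_sq] by (simp add: fun_inner_self)
    then have "ae_class M (rep g) = ae_class M p"
      by (intro ae_class_cong) (auto elim: eventually_mono)
    then show "g = ae_class M p" using rep_L2(2)[OF E_L2[OF g(1)]] by simp
  qed
qed

text \<open>Pairing with \<open>h\<close> in the eigenspace kills the component removed by the
  projection, which turns the operator identity into one between integrals.\<close>

lemma L2_proj_mult_op_eq_scale:
  assumes \<sigma>: "\<sigma> \<in> Linf M"
  defines "E \<equiv> eigenspace M D (perturbed M L q) z"
  assumes u: "u \<in> E" and h: "h \<in> E"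
    and proj: "L2_proj M E (mult_op M \<sigma> u) = ae_scale M (complex_of_real c) u"
  shows "(LINT x|M. complex_of_real (rep \<sigma> x) * (rep u x * cnj (rep h x))) =
    complex_of_real c * fun_inner M (rep u) (rep h)"
proof -
  have L2: "u \<in> L2 M" "h \<in> L2 M" using u h eigenspace_subset_L2 by (auto simp: E_def)
  note ru = rep_L2(1)[OF L2(1)] and rh = rep_L2(1)[OF L2(2)]
  note su = Linf_mult_sq_integrable[OF \<sigma> ru] and cu = scale_sq_integrable[OF ru, of "complex_of_real c"]
  have mu: "mult_op M \<sigma> u \<in> L2 M"
    unfolding mult_op_def by (rule ae_class_in_L2[OF su])
  have "L2_inner M (ae_diff M (mult_op M \<sigma> u) (ae_scale M (complex_of_real c) u)) h = 0"
    using L2_proj_eigenspace[OF mu] h proj unfolding E_def by metis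
  moreover have "L2_inner M (ae_diff M (mult_op M \<sigma> u) (ae_scale M (complex_of_real c) u)) h =
      fun_inner M (rep (mult_op M \<sigma> u)) (rep h) - fun_inner M (rep (ae_scale M (complex_of_real c) u)) (rep h)"
    unfolding ae_diff_def
    by (subst L2_inner_ae_class) (intro diff_sq_integrable fun_inner_diff_left rep_L2 mu L2
        ae_class_in_L2[OF cu, folded ae_scale_def])+
  moreover have "fun_inner M (rep (mult_op M \<sigma> u)) (rep h) = fun_inner M (\<lambda>x. complex_of_real (rep \<sigma> x) * rep u x) (rep h)"
    using L2_inner_ae_class[OF su L2(2)] by (simp add: mult_op_def L2_inner_def fun_inner_def)
  moreover have "fun_inner M (rep (ae_scale M (complex_of_real c) u)) (rep h) = complex_of_real c * fun_inner M (rep u) (rep h)"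
    using L2_inner_ae_class[OF cu L2(2)] fun_inner_scale_left[of M "complex_of_real c" "rep u" "rep h"]
    by (simp add: ae_scale_def L2_inner_def fun_inner_def)
  ultimately show ?thesis by (simp add: fun_inner_def mult.assoc)
qed

end

text \<open>If no finite independent set had two elements, the supremum defining the dimension would
  be at most 1.\<close>

lemma L2_dim_ge_2E:
  assumes "2 \<le> L2_dim M E"
  obtains u v where "u \<in> E" "v \<in> E"
    "\<And>a b. AE x in M. a * rep u x + b * rep v x = 0 \<Longrightarrow> a = 0 \<and> b = 0"
proof -
  have "\<exists>B. finite B \<and> B \<subseteq> E \<and> L2_independent M B \<and> \<not> card B \<le> Suc 0"
  proof (rule ccontr)
    assume "\<not> ?thesis"
    then have "L2_dim M E \<le> enat (Suc 0)"
      unfolding L2_dim_def by (intro SUP_least) auto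
    then have "2 \<le> enat (Suc 0)" using assms by (rule order_trans[rotated])
    then show False by (simp add: numeral_eq_enat)
  qed
  then obtain B where B: "finite B" "B \<subseteq> E" "L2_independent M B" "\<not> card B \<le> Suc 0" by blast
  then obtain u v where uv: "u \<in> B" "v \<in> B" "u \<noteq> v"
    using card_le_Suc0_iff_eq[OF B(1)] by blast
  have ind: "a = 0 \<and> b = 0" if ab: "AE x in M. a * rep u x + b * rep v x = 0" for a b
  proof -
    \<comment> \<open>Coefficients vanish off the chosen pair, so independence of the whole of
      \<open>B\<close> restricts to \<open>u\<close> and \<open>v\<close>.\<close>
    define c where "c w = (if w = u then a else if w = v then b else 0)" for w
    have "(\<Sum>w\<in>B. c w * rep w x) = a * rep u x + b * rep v x" for x
    proof -
      have "(\<Sum>w\<in>B. c w * rep w x) = (\<Sum>w\<in>{u, v}. c w * rep w x)"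
        using B(1) uv by (intro sum.mono_neutral_right) (auto simp: c_def)
      then show ?thesis using uv(3) by (simp add: c_def)
    qed
    then have "ae_class M (\<lambda>x. \<Sum>w\<in>B. c w * rep w x) = ae_zero M"
      unfolding ae_zero_def using ab by (intro ae_class_cong) simp
    then have "\<forall>w\<in>B. c w = 0"
      using B(3) unfolding L2_independent_def by blast
    then have "c u = 0" "c v = 0" using uv(1,2) by blast+
    then show ?thesis using uv(3) by (simp add: c_def)
  qed
  have "u \<in> E" "v \<in> E" using uv(1,2) B(2) by blast+
  then show thesis by (rule that[OF _ _ ind])
qed

text \<open>If every multiplication acts as a scalar on the span of \<open>u\<close> and \<open>v\<close>, replace \<open>v\<close> by
  its component \<open>v'\<close> orthogonal to \<open>u\<close>: all multiplications being scalar forces \<open>u cnj v' = 0\<close>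
  and makes \<open>|u|\<^sup>2\<close> and \<open>|v'|\<^sup>2\<close> proportional almost everywhere.\<close>

lemma no_scalar_multiplications:
  assumes S: "S \<subseteq> sq_integrable M"
    and sep: "\<And>w. integrable M w \<Longrightarrow>
        (\<And>f. f \<in> \<Phi> \<Longrightarrow> (LINT x|M. complex_of_real (f x) * w x) = 0) \<Longrightarrow> AE x in M. w x = (0::complex)"
    and int: "\<And>f w. f \<in> \<Phi> \<Longrightarrow> integrable M (w :: 'a \<Rightarrow> complex) \<Longrightarrow> integrable M (\<lambda>x. complex_of_real (f x) * w x)"
    and scalar: "\<And>f. f \<in> \<Phi> \<Longrightarrow> \<exists>c::complex. \<forall>g\<in>orth_complement M S. \<forall>h\<in>orth_complement M S.
        (LINT x|M. complex_of_real (f x) * (g x * cnj (h x))) = c * fun_inner M g h"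
    and u: "u \<in> orth_complement M S" and v: "v \<in> orth_complement M S"
    and ind: "\<And>a b. AE x in M. a * u x + b * v x = 0 \<Longrightarrow> a = 0 \<and> b = (0::complex)"
  shows False
proof -
  have sq: "g \<in> sq_integrable M" if "g \<in> orth_complement M S" for g
    using that by (simp add: orth_complement_def)
  have Nu: "sq_norm M u \<noteq> 0"
    using ind[of 1 0] sq_norm_eq_0_iff[OF sq[OF u]] by auto
  define a where "a = fun_inner M v u / complex_of_real (sq_norm M u)"
  define v' where "v' x = v x + (- a) * u x" for x
  have v': "v' \<in> orth_complement M S"
    unfolding v'_def[abs_def] by (rule orth_complement_add_scale[OF S v u])
  have "fun_inner M v' u = fun_inner M v u + (- a) * fun_inner M u u"
    unfolding v'_def[abs_def]
    by (subst fun_inner_add_left[OF sq[OF v] scale_sq_integrable[OF sq[OF u]] sq[OF u]])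
      (simp only: fun_inner_scale_left)
  then have orth: "fun_inner M u v' = 0"
    using Nu fun_inner_cnj[of M u v'] by (simp add: a_def fun_inner_self)
  have Nv': "sq_norm M v' \<noteq> 0"
    using ind[of "- a" 1] sq_norm_eq_0_iff[OF sq[OF v']] by (auto simp: v'_def algebra_simps)
  have 1: "AE x in M. u x * cnj (v' x) = 0"
  proof (rule sep)
    show "integrable M (\<lambda>x. u x * cnj (v' x))"
      by (rule fun_inner_integrable[OF sq[OF u] sq[OF v']])
    show "(LINT x|M. complex_of_real (f x) * (u x * cnj (v' x))) = 0" if "f \<in> \<Phi>" for f
      using scalar[OF that] u v' orth by (metis mult_zero_right)
  qed
  let ?A = "complex_of_real (sq_norm M v')" and ?B = "complex_of_real (sq_norm M u)"
  \<comment> \<open>One constant \<open>c\<close> serves both \<open>u\<close> and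
    \<open>v'\<close>; weighting each square by the norm of the other makes the two contributions
    cancel.\<close>
  have 2: "AE x in M. ?A * (u x * cnj (u x)) - ?B * (v' x * cnj (v' x)) = 0"
  proof (rule sep)
    note iu = fun_inner_integrable[OF sq[OF u] sq[OF u]] and iv = fun_inner_integrable[OF sq[OF v'] sq[OF v']]
    show "integrable M (\<lambda>x. ?A * (u x * cnj (u x)) - ?B * (v' x * cnj (v' x)))"
      using iu iv by auto
    fix f assume f: "f \<in> \<Phi>"
    obtain c where c: "(LINT x|M. complex_of_real (f x) * (u x * cnj (u x))) = c * fun_inner M u u"
      "(LINT x|M. complex_of_real (f x) * (v' x * cnj (v' x))) = c * fun_inner M v' v'"
      using scalar[OF f] u v' by metis
    have "(LINT x|M. complex_of_real (f x) * (?A * (u x * cnj (u x)) - ?B * (v' x * cnj (v' x)))) =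
        (LINT x|M. ?A * (complex_of_real (f x) * (u x * cnj (u x))) - ?B * (complex_of_real (f x) * (v' x * cnj (v' x))))"
      by (simp only: right_diff_distrib mult.left_commute)
    also have "\<dots> = ?A * (c * fun_inner M u u) - ?B * (c * fun_inner M v' v')"
      unfolding c[symmetric] using int[OF f iu] int[OF f iv]
      by (subst Bochner_Integration.integral_diff) (auto intro: integrable_mult_right)
    also have "\<dots> = 0" by (simp add: fun_inner_self)
    finally show "(LINT x|M. complex_of_real (f x) * (?A * (u x * cnj (u x)) - ?B * (v' x * cnj (v' x)))) = 0" .
  qed
  \<comment> \<open>At a point where \<open>u\<close> is nonzero, the first relation gives
    \<open>v' = 0\<close>, and then the second gives \<open>?A = 0\<close>, contrary to
    \<open>Nv'\<close>.\<close>
  have "AE x in M. u x = 0"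
    using 1 2 by eventually_elim (use Nv' in auto)
  then show False using Nu sq_norm_eq_0_iff[OF sq[OF u]] by simp
qed

theorem corollary2p4:
  fixes n :: nat
    and \<A> :: "('a::{t2_space, second_countable_topology}, 'e::euclidean_space) chart set"
    and \<mu> :: "'a measure"
    and D :: "('a, complex) fclass set"
    and L :: "'a L2_map"
    and T :: "'q::real_vector topology"
    and \<iota> :: "'q \<Rightarrow> ('a, real) fclass"
  assumes "smooth_manifold_with_boundary n \<A>"
    and "positive_smooth_density n \<A> \<mu>"
    and "self_adjoint_operator \<mu> D L"
    and "admissible_perturbation_space \<mu> T \<iota>"
    and "ae_class \<mu> ` Cc_infty_interior n \<A> \<subseteq> range \<iota>"
  shows "hypothesis_H \<mu> D L \<iota>"
proof -
  have Linf: "\<iota> r \<in> Linf \<mu>" for r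
    using assms(4) by (auto simp: admissible_perturbation_space_def)
  have False if dim: "2 \<le> L2_dim \<mu> (eigenspace \<mu> D (perturbed \<mu> L (\<iota> q)) z)"
    and scalar: "\<And>\<sigma>. \<exists>c::real. \<forall>u\<in>eigenspace \<mu> D (perturbed \<mu> L (\<iota> q)) z.
      L2_proj \<mu> (eigenspace \<mu> D (perturbed \<mu> L (\<iota> q)) z) (mult_op \<mu> (\<iota> \<sigma>) u) =
      ae_scale \<mu> (complex_of_real c) u" for q z
  proof -
    let ?E = "eigenspace \<mu> D (perturbed \<mu> L (\<iota> q)) z"
    let ?S = "shifted_range \<mu> D L (\<iota> q) z"
    note ctx = assms(3) Linf[of q]
    obtain u v where uv: "u \<in> ?E" "v \<in> ?E"
      and ind: "\<And>a b. AE x in \<mu>. a * rep u x + b * rep v x = 0 \<Longrightarrow> a = 0 \<and> b = 0"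
      using L2_dim_ge_2E[OF dim] by blast
    have sets: "sets \<mu> = sets borel"
      using assms(2) by (simp add: positive_smooth_density_def)
    have rep_E: "rep w \<in> orth_complement \<mu> ?S" if "w \<in> ?E" for w
      using eigenspace_iff[OF ctx] eigenspace_subset_L2[OF ctx] that by blast
    \<comment> \<open>The constant is fixed by the test function alone, before \<open>g\<close> and
      \<open>h\<close> are chosen; the cancellation of constants relies on this order.\<close>
    have multiplications_scalar: "\<exists>c::complex. \<forall>g\<in>orth_complement \<mu> ?S. \<forall>h\<in>orth_complement \<mu> ?S.
        (LINT x|\<mu>. complex_of_real (f x) * (g x * cnj (h x))) = c * fun_inner \<mu> g h"
      if f: "f \<in> Cc_infty_interior n \<A>" for f
    proof -
      have f_meas: "f \<in> borel_measurable \<mu>"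
        using borel_measurable_continuous_onI[OF Cc_continuous_bounded(1)[OF assms(1) f]]
        by (simp add: measurable_cong_sets[OF sets refl])
      \<comment> \<open>The inclusion of the test functions in the perturbation space is applied
        here, on the level of classes; \<open>rep\<close> may therefore return a different function
        that agrees with \<open>f\<close> almost everywhere.\<close>
      obtain \<sigma> where \<sigma>: "\<iota> \<sigma> = ae_class \<mu> f" using assms(5) f by (metis imageE image_subset_iff)
      note rf = rep_ae_class[OF f_meas, folded \<sigma>]
      obtain c :: real where c: "\<And>u. u \<in> ?E \<Longrightarrow>
          L2_proj \<mu> ?E (mult_op \<mu> (\<iota> \<sigma>) u) = ae_scale \<mu> (complex_of_real c) u"
        using scalar[of \<sigma>] by blast
      have "(LINT x|\<mu>. complex_of_real (f x) * (g x * cnj (h x))) = complex_of_real c * fun_inner \<mu> g h"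
        if g: "g \<in> orth_complement \<mu> ?S" and h: "h \<in> orth_complement \<mu> ?S" for g h
      proof -
        have sq: "g \<in> sq_integrable \<mu>" "h \<in> sq_integrable \<mu>"
          using g h by (auto simp: orth_complement_def)
        note [measurable] = sq[THEN sq_integrable_measurable] f_meas rf(1)
        note rg = rep_ae_class[OF sq_integrable_measurable[OF sq(1)]]
          and rh = rep_ae_class[OF sq_integrable_measurable[OF sq(2)]]
        note [measurable] = rg(1) rh(1)
        note Eg = ae_class_in_eigenspace[OF ctx g] and Eh = ae_class_in_eigenspace[OF ctx h]
        have "(LINT x|\<mu>. complex_of_real (f x) * (g x * cnj (h x))) =
            (LINT x|\<mu>. complex_of_real (rep (\<iota> \<sigma>) x) * (rep (ae_class \<mu> g) x * cnj (rep (ae_class \<mu> h) x)))"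
        proof (rule integral_cong_AE)
          show "AE x in \<mu>. complex_of_real (f x) * (g x * cnj (h x)) =
              complex_of_real (rep (\<iota> \<sigma>) x) * (rep (ae_class \<mu> g) x * cnj (rep (ae_class \<mu> h) x))"
            using rf(2) rg(2) rh(2) by eventually_elim simp
        qed measurable
        also have "\<dots> = complex_of_real c * fun_inner \<mu> (rep (ae_class \<mu> g)) (rep (ae_class \<mu> h))"
          by (rule L2_proj_mult_op_eq_scale[OF ctx Linf Eg Eh c[OF Eg]])
        also have "fun_inner \<mu> (rep (ae_class \<mu> g)) (rep (ae_class \<mu> h)) = fun_inner \<mu> g h"
          by (rule fun_inner_cong_AE[OF rep_ae_class_sq_integrable[OF sq(1)] sq(1)
                rep_ae_class_sq_integrable[OF sq(2)] sq(2) rg(2) rh(2)])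
        finally show ?thesis .
      qed
      then show ?thesis by blast
    qed
    have separating: "AE x in \<mu>. w x = 0" if "integrable \<mu> w"
      "\<And>f. f \<in> Cc_infty_interior n \<A> \<Longrightarrow> (LINT x|\<mu>. complex_of_real (f x) * w x) = 0"
      for w :: "'a \<Rightarrow> complex"
      by (rule AE_zero_of_orthogonal_Cc[OF assms(1,2) that])
    show False
      by (rule no_scalar_multiplications[where \<Phi> = "Cc_infty_interior n \<A>",
            OF shifted_range_subset[OF ctx] separating Cc_mult_integrable[OF assms(1,2)]
              multiplications_scalar rep_E[OF uv(1)] rep_E[OF uv(2)] ind])
  qed
  then show ?thesis
    unfolding hypothesis_H_def Let_def by blast
qed

end
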